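(* If there exists a ring satisfying (NK), then there exist a simple right self-injective von Neumann regular ring $T$ which is of Type $\mathrm{II}_f$ or of Type $\mathrm{III}$, and a countable subring $B$ of $T$ such that $B$ is a local ring and $B$ satisfies (NK).
   Context: All rings are associative with unit. A right ideal is nil if all its elements are nilpotent; a ring satisfies the condition (NK) if it contains two nil right ideals whose sum is not nil. A ring is local if it has a unique maximal right ideal. A ring $R$ is von Neumann regular (VNR) if for every $x\in R$ there is $y$ with $x=xyx$; a VNR ring is abelian regular if all its idempotents are central. A ring is directly finite if $xy=1$ implies $yx=1$. For a right self-injective VNR ring $R$: an idempotent $e$ is abelian if $eRe$ is abelian regular, and directly finite if $eRe$ is directly finite. $R$ is of Type $\mathrm{II}$ if $R$ has no nonzero abelian idempotents and every nonzero right ideal of $R$ contains a nonzero directly finite idempotent; $R$ is of Type $\mathrm{II}_f$ if it is of Type $\mathrm{II}$ and directly finite; $R$ is of Type $\mathrm{III}$ if it contains no nonzero directly finite idempotent. *)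

theory Defs
  imports "HOL-Algebra.Algebra" "HOL-Library.Countable_Set"
begin

definition nilpotent_elem :: "('a, 'm) ring_scheme \<Rightarrow> 'a \<Rightarrow> bool" where
  "nilpotent_elem R x \<longleftrightarrow> (\<exists>n::nat. x [^]\<^bsub>R\<^esub> n = \<zero>\<^bsub>R\<^esub>)"

definition nil_set :: "('a, 'm) ring_scheme \<Rightarrow> 'a set \<Rightarrow> bool" where
  "nil_set R I \<longleftrightarrow> (\<forall>x\<in>I. nilpotent_elem R x)"

definition right_ideal :: "'a set \<Rightarrow> ('a, 'm) ring_scheme \<Rightarrow> bool" where
  "right_ideal I R \<longleftrightarrow> additive_subgroup I R \<and>
     (\<forall>a\<in>I. \<forall>x\<in>carrier R. a \<otimes>\<^bsub>R\<^esub> x \<in> I)"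

definition ideal_sum :: "('a, 'm) ring_scheme \<Rightarrow> 'a set \<Rightarrow> 'a set \<Rightarrow> 'a set" where
  "ideal_sum R I J = {x \<oplus>\<^bsub>R\<^esub> y | x y. x \<in> I \<and> y \<in> J}"

definition NK :: "('a, 'm) ring_scheme \<Rightarrow> bool" where
  "NK R \<longleftrightarrow> (\<exists>I J. right_ideal I R \<and> right_ideal J R \<and> nil_set R I \<and> nil_set R J \<and>
                 \<not> nil_set R (ideal_sum R I J))"

definition maximal_right_ideal :: "'a set \<Rightarrow> ('a, 'm) ring_scheme \<Rightarrow> bool" where
  "maximal_right_ideal M R \<longleftrightarrow> right_ideal M R \<and> M \<noteq> carrier R \<and>
     (\<forall>J. right_ideal J R \<and> M \<subseteq> J \<and> J \<noteq> carrier R \<longrightarrow> J = M)"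

definition local_ring :: "('a, 'm) ring_scheme \<Rightarrow> bool" where
  "local_ring R \<longleftrightarrow> (\<exists>!M. maximal_right_ideal M R)"

definition von_neumann_regular :: "('a, 'm) ring_scheme \<Rightarrow> bool" where
  "von_neumann_regular R \<longleftrightarrow>
     (\<forall>x\<in>carrier R. \<exists>y\<in>carrier R. x = x \<otimes>\<^bsub>R\<^esub> y \<otimes>\<^bsub>R\<^esub> x)"

definition idempotent_elem :: "('a, 'm) ring_scheme \<Rightarrow> 'a \<Rightarrow> bool" where
  "idempotent_elem R e \<longleftrightarrow> e \<in> carrier R \<and> e \<otimes>\<^bsub>R\<^esub> e = e"

definition abelian_regular :: "('a, 'm) ring_scheme \<Rightarrow> bool" where
  "abelian_regular R \<longleftrightarrow> von_neumann_regular R \<and>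
     (\<forall>e. idempotent_elem R e \<longrightarrow> (\<forall>x\<in>carrier R. e \<otimes>\<^bsub>R\<^esub> x = x \<otimes>\<^bsub>R\<^esub> e))"

definition directly_finite :: "('a, 'm) ring_scheme \<Rightarrow> bool" where
  "directly_finite R \<longleftrightarrow> (\<forall>x\<in>carrier R. \<forall>y\<in>carrier R.
      x \<otimes>\<^bsub>R\<^esub> y = \<one>\<^bsub>R\<^esub> \<longrightarrow> y \<otimes>\<^bsub>R\<^esub> x = \<one>\<^bsub>R\<^esub>)"

definition corner_ring :: "('a, 'm) ring_scheme \<Rightarrow> 'a \<Rightarrow> ('a, 'm) ring_scheme" where
  "corner_ring R e = R\<lparr>carrier := {e \<otimes>\<^bsub>R\<^esub> x \<otimes>\<^bsub>R\<^esub> e | x. x \<in> carrier R}, one := e\<rparr>"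

definition abelian_idempotent :: "('a, 'm) ring_scheme \<Rightarrow> 'a \<Rightarrow> bool" where
  "abelian_idempotent R e \<longleftrightarrow> idempotent_elem R e \<and> abelian_regular (corner_ring R e)"

definition directly_finite_idempotent :: "('a, 'm) ring_scheme \<Rightarrow> 'a \<Rightarrow> bool" where
  "directly_finite_idempotent R e \<longleftrightarrow> idempotent_elem R e \<and> directly_finite (corner_ring R e)"

text \<open>Right self-injectivity of R (i.e. R_R is an injective right R-module), expressed via
  Baer's criterion: every right R-module homomorphism from a right ideal into R_R is
  given by left multiplication by an element of R.\<close>
definition right_self_injective :: "('a, 'm) ring_scheme \<Rightarrow> bool" where
  "right_self_injective R \<longleftrightarrow>
     (\<forall>I f. right_ideal I R \<and> f ` I \<subseteq> carrier R \<and>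
        (\<forall>a\<in>I. \<forall>b\<in>I. f (a \<oplus>\<^bsub>R\<^esub> b) = f a \<oplus>\<^bsub>R\<^esub> f b) \<and>
        (\<forall>a\<in>I. \<forall>x\<in>carrier R. f (a \<otimes>\<^bsub>R\<^esub> x) = f a \<otimes>\<^bsub>R\<^esub> x)
      \<longrightarrow> (\<exists>c\<in>carrier R. \<forall>a\<in>I. f a = c \<otimes>\<^bsub>R\<^esub> a))"

definition simple_ring :: "('a, 'm) ring_scheme \<Rightarrow> bool" where
  "simple_ring R \<longleftrightarrow> \<zero>\<^bsub>R\<^esub> \<noteq> \<one>\<^bsub>R\<^esub> \<and>
     (\<forall>I. ideal I R \<longrightarrow> I = {\<zero>\<^bsub>R\<^esub>} \<or> I = carrier R)"

definition type_II :: "('a, 'm) ring_scheme \<Rightarrow> bool" where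
  "type_II R \<longleftrightarrow>
     (\<forall>e. abelian_idempotent R e \<longrightarrow> e = \<zero>\<^bsub>R\<^esub>) \<and>
     (\<forall>I. right_ideal I R \<and> I \<noteq> {\<zero>\<^bsub>R\<^esub>} \<longrightarrow>
        (\<exists>e\<in>I. e \<noteq> \<zero>\<^bsub>R\<^esub> \<and> directly_finite_idempotent R e))"

definition type_II_f :: "('a, 'm) ring_scheme \<Rightarrow> bool" where
  "type_II_f R \<longleftrightarrow> type_II R \<and> directly_finite R"

definition type_III :: "('a, 'm) ring_scheme \<Rightarrow> bool" where
  "type_III R \<longleftrightarrow> (\<forall>e. directly_finite_idempotent R e \<longrightarrow> e = \<zero>\<^bsub>R\<^esub>)"

end

theory Submission
  imports Defs
begin

text \<open>Let \<open>a + b\<close> be non-nilpotent with \<open>a R\<close> and \<open>b R\<close> nil. Passing to the subring generated by \<open>a\<close>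
  and \<open>b\<close> and dividing by an ideal maximal with respect to avoiding the powers of \<open>a + b\<close> yields a
  countable prime ring \<open>A\<close>. In the ring \<open>S\<close> of power series over \<open>A\<close> in countably many noncommuting
  variables, let \<open>t = \<Sum>\<^sub>k e\<^sub>k X\<^sub>k\<close>, where \<open>e\<close> enumerates \<open>A\<close>: comparing terms of lowest degree,
  primeness of \<open>A\<close> gives \<open>x t y \<noteq> 0\<close> for all nonzero \<open>x\<close>, \<open>y\<close>. So \<open>S\<close> is right nonsingular and its
  maximal right quotient ring \<open>T\<close> is right self-injective and von Neumann regular. For \<open>0 \<noteq> x \<in> S\<close> the
  element \<open>x t\<close> has zero right annihilator, hence a left inverse in \<open>T\<close>; as \<open>S\<close> is essential in \<open>T\<close>,
  every nonzero \<open>q \<in> T\<close> satisfies \<open>v q u = 1\<close> for some \<open>u\<close>, \<open>v\<close>. This makes \<open>T\<close> simple and, since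
  \<open>X\<^sub>0\<close> has a left inverse but is not invertible, of Type III. Finally \<open>B\<close> consists of the fractions
  \<open>z\<^sup>-\<^sup>1 x\<close> with \<open>x\<close>, \<open>z\<close> in the image of \<open>A\<close> and \<open>z\<close> central in \<open>T\<close>; modulo its Jacobson radical,
  which contains \<open>a\<close> and \<open>b\<close>, it is a field.\<close>

section \<open>Right ideals, radical, and rings of Type III\<close>

text \<open>The maximal right quotient ring of \<open>A\<close> itself would not do:
  \<open>A\<close> may have a nonzero right singular ideal, and primeness only provides, for each
  pair \<open>x\<close>, \<open>y\<close>, an \<open>r\<close> depending on the pair with
  \<open>x r y \<noteq> 0\<close>. The series \<open>t\<close> carries every \<open>r\<close> at
  once in separate coefficients of degree one, which turns primeness into a statement about one
  fixed element; countability of \<open>A\<close> lets the variables be indexed by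
  \<open>nat\<close>. The image of \<open>A\<close> in \<open>T\<close> need not be local, since
  modulo the ideal generated by \<open>a\<close> and \<open>b\<close> it is only an image of the
  integers. Denominators are inverted for this reason, and central ones are chosen because they are
  units of \<open>T\<close> (if \<open>z\<close> is central, \<open>v z u = 1\<close> already
  inverts it) and because a central factor pulls out of powers, so that \<open>a B\<close> and
  \<open>b B\<close> stay nil. \<open>T\<close> has to live on the prescribed type
  \<open>'c\<close>. A series over a countable ring is coded by a set of naturals and an element of
  the quotient ring by a set of such sets, which accounts for the injection from
  \<open>nat set set\<close>.\<close>

context ring
begin

text \<open>Negatives need no clause of their own: \<open>\<ominus> x\<close> is \<open>x\<close>
  multiplied on the right by \<open>\<ominus> \<one>\<close>.\<close>

lemma right_idealI:
  assumes "I \<subseteq> carrier R" "\<zero> \<in> I"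
    and "\<And>x y. x \<in> I \<Longrightarrow> y \<in> I \<Longrightarrow> x \<oplus> y \<in> I"
    and r: "\<And>x r. x \<in> I \<Longrightarrow> r \<in> carrier R \<Longrightarrow> x \<otimes> r \<in> I"
  shows "right_ideal I R"
proof -
  have "\<ominus> x \<in> I" if "x \<in> I" for x
    using r[OF that, of "\<ominus> \<one>"] that assms(1) by (auto simp: r_minus)
  hence "subgroup I (add_monoid R)"
    by (intro add.subgroupI) (use assms in \<open>auto simp: a_inv_def\<close>)
  thus ?thesis
    unfolding right_ideal_def using r by (auto intro: additive_subgroup.intro)
qed

lemma right_idealD:
  assumes "right_ideal I R"
  shows "I \<subseteq> carrier R" "\<zero> \<in> I"
    and "\<And>x y. x \<in> I \<Longrightarrow> y \<in> I \<Longrightarrow> x \<oplus> y \<in> I"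
    and "\<And>x r. x \<in> I \<Longrightarrow> r \<in> carrier R \<Longrightarrow> x \<otimes> r \<in> I"
    and "\<And>x. x \<in> I \<Longrightarrow> \<ominus> x \<in> I"
    and "\<And>x y. x \<in> I \<Longrightarrow> y \<in> I \<Longrightarrow> x \<ominus> y \<in> I"
proof -
  interpret additive_subgroup I R
    using assms by (simp add: right_ideal_def)
  show "I \<subseteq> carrier R" "\<zero> \<in> I"
    and "\<And>x y. x \<in> I \<Longrightarrow> y \<in> I \<Longrightarrow> x \<oplus> y \<in> I"
    and "\<And>x. x \<in> I \<Longrightarrow> \<ominus> x \<in> I"
    and "\<And>x y. x \<in> I \<Longrightarrow> y \<in> I \<Longrightarrow> x \<ominus> y \<in> I"
    using a_subset by (auto simp: minus_eq)
  show "\<And>x r. x \<in> I \<Longrightarrow> r \<in> carrier R \<Longrightarrow> x \<otimes> r \<in> I"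
    using assms by (simp add: right_ideal_def)
qed

lemma right_ideal_carrier: "right_ideal (carrier R) R"
  by (rule right_idealI) auto

lemma right_ideal_Int:
  assumes "right_ideal I R" "right_ideal J R"
  shows "right_ideal (I \<inter> J) R"
  by (rule right_idealI) (use right_idealD[OF assms(1)] right_idealD[OF assms(2)] in auto)

lemma right_ideal_principal:
  assumes "x \<in> carrier R"
  shows "right_ideal {x \<otimes> r |r. r \<in> carrier R} R"
proof (rule right_idealI)
  show "\<zero> \<in> {x \<otimes> r |r. r \<in> carrier R}"
    using assms by (auto intro!: exI[of _ \<zero>])
  show "y \<oplus> z \<in> {x \<otimes> r |r. r \<in> carrier R}"
    if "y \<in> {x \<otimes> r |r. r \<in> carrier R}" "z \<in> {x \<otimes> r |r. r \<in> carrier R}" for y z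
    using that assms by (force simp: r_distr[symmetric])
  show "y \<otimes> r \<in> {x \<otimes> r |r. r \<in> carrier R}"
    if "y \<in> {x \<otimes> r |r. r \<in> carrier R}" "r \<in> carrier R" for y r
    using that assms by (force simp: m_assoc)
qed (use assms in auto)

lemma right_idealI_one:
  assumes "right_ideal I R" "x \<in> I" "u \<in> carrier R" "x \<otimes> u = \<one>"
  shows "I = carrier R"
proof -
  have "\<one> \<in> I"
    using right_idealD(4)[OF assms(1,2,3)] assms(4) by simp
  thus ?thesis
    using right_idealD(1)[OF assms(1)] right_idealD(4)[OF assms(1), of \<one>] by force
qed

text \<open>The Jacobson radical in its one-sided elementwise form. That it also absorbs
  multiplication from the left is \<open>jac_left\<close>.\<close>

definition jac :: "'a set" where
  "jac = {z \<in> carrier R. \<forall>r\<in>carrier R. \<exists>u\<in>carrier R. (\<one> \<oplus> z \<otimes> r) \<otimes> u = \<one>}"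

text \<open>Geometric series: the witness built by the induction is
  \<open>1 + v + ... + v^(n-1)\<close>, and telescoping leaves \<open>1 - v^n\<close>.\<close>

lemma one_minus_nilpotent:
  assumes "v \<in> carrier R" "v [^] (n::nat) = \<zero>"
  shows "\<exists>u\<in>carrier R. (\<one> \<ominus> v) \<otimes> u = \<one>"
proof -
  have "\<exists>u\<in>carrier R. (\<one> \<ominus> v) \<otimes> u = \<one> \<ominus> v [^] n" for n :: nat
  proof (induction n)
    case 0
    show ?case
      by (rule bexI[of _ \<zero>]) (use assms in \<open>auto simp: minus_eq r_neg\<close>)
  next
    case (Suc n)
    then obtain u where u: "u \<in> carrier R" "(\<one> \<ominus> v) \<otimes> u = \<one> \<ominus> v [^] n" by blast
    have p: "v [^] Suc n = v \<otimes> v [^] n"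
      using assms(1) by (rule nat_pow_Suc2)
    have c: "v [^] n \<in> carrier R" using assms(1) by simp
    have "(\<one> \<ominus> v) \<otimes> (u \<oplus> v [^] n) = (\<one> \<ominus> v [^] n) \<oplus> (v [^] n \<ominus> v \<otimes> v [^] n)"
      using assms(1) u c by (simp add: r_distr l_distr minus_eq l_minus)
    also have "\<dots> = \<one> \<ominus> v [^] Suc n"
      unfolding p using assms(1) c
      by (simp add: minus_eq a_assoc) (simp add: a_assoc[symmetric] l_neg)
    finally show ?case using u c by blast
  qed
  from this[of n] show ?thesis
    using assms by (simp add: minus_eq)
qed

text \<open>Nil right ideals lie in the radical. Nilpotency is used at \<open>\<ominus> r\<close>,
  because \<open>1 - z (-r)\<close> is the element \<open>1 + z r\<close> that \<open>jac\<close>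
  speaks of.\<close>

lemma nil_imp_jac:
  assumes z: "z \<in> carrier R" and nil: "\<And>r. r \<in> carrier R \<Longrightarrow> nilpotent_elem R (z \<otimes> r)"
  shows "z \<in> jac"
  unfolding jac_def
proof (intro CollectI conjI ballI z)
  fix r assume r: "r \<in> carrier R"
  obtain n :: nat where "(z \<otimes> (\<ominus> r)) [^] n = \<zero>"
    using nil[of "\<ominus> r"] r by (auto simp: nilpotent_elem_def)
  then obtain u where "u \<in> carrier R" "(\<one> \<ominus> z \<otimes> (\<ominus> r)) \<otimes> u = \<one>"
    using one_minus_nilpotent[of "z \<otimes> (\<ominus> r)" n] z r by auto
  thus "\<exists>u\<in>carrier R. (\<one> \<oplus> z \<otimes> r) \<otimes> u = \<one>"
    using z r by (auto simp: minus_eq r_minus)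
qed

lemma jac_right_ideal: "right_ideal jac R"
proof (rule right_idealI)
  show "jac \<subseteq> carrier R" by (auto simp: jac_def)
  show "\<zero> \<in> jac" by (auto simp: jac_def)
next
  fix z w assume zw: "z \<in> jac" "w \<in> jac"
  hence c: "z \<in> carrier R" "w \<in> carrier R" by (auto simp: jac_def)
  show "z \<oplus> w \<in> jac"
    unfolding jac_def
  proof (intro CollectI conjI ballI)
    fix r assume r: "r \<in> carrier R"
    obtain u where u: "u \<in> carrier R" "(\<one> \<oplus> z \<otimes> r) \<otimes> u = \<one>"
      using zw(1) r by (auto simp: jac_def)
    obtain u' where u': "u' \<in> carrier R" "(\<one> \<oplus> w \<otimes> (r \<otimes> u)) \<otimes> u' = \<one>"
      using zw(2) r u by (auto simp: jac_def)
    \<comment> \<open>Multiplying by \<open>u\<close> collapses the part belonging to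
      \<open>z\<close> to \<open>\<one>\<close>; what remains is \<open>1 + w (r u)\<close>, which
      \<open>u'\<close> inverts.\<close>
    have "(\<one> \<oplus> (z \<oplus> w) \<otimes> r) \<otimes> (u \<otimes> u') = ((\<one> \<oplus> z \<otimes> r) \<otimes> u \<oplus> w \<otimes> (r \<otimes> u)) \<otimes> u'"
      using c r u(1) u'(1) by (simp add: l_distr m_assoc a_assoc)
    also have "\<dots> = \<one>" using u u' by simp
    finally show "\<exists>u\<in>carrier R. (\<one> \<oplus> (z \<oplus> w) \<otimes> r) \<otimes> u = \<one>"
      using u u' by blast
  qed (use c in simp)
next
  fix z r assume z: "z \<in> jac" "r \<in> carrier R"
  thus "z \<otimes> r \<in> jac"
    by (auto simp: jac_def m_assoc)
qed

text \<open>One-sided inverses move between \<open>1 + z (r q)\<close> and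
  \<open>1 + q (z r)\<close>: if \<open>y\<close> is a right inverse of the former, then
  \<open>1 - q y z r\<close> is one of the latter.\<close>

lemma jac_left:
  assumes z: "z \<in> jac" and q: "q \<in> carrier R"
  shows "q \<otimes> z \<in> jac"
  unfolding jac_def
proof (intro CollectI conjI ballI)
  have c: "z \<in> carrier R" using z by (auto simp: jac_def)
  show "q \<otimes> z \<in> carrier R" using c q by simp
  fix r assume r: "r \<in> carrier R"
  obtain y where y: "y \<in> carrier R" "(\<one> \<oplus> z \<otimes> (r \<otimes> q)) \<otimes> y = \<one>"
    using z r q by (auto simp: jac_def)
  define w where "w = q \<otimes> (z \<otimes> r)"
  define v where "v = q \<otimes> (y \<otimes> (z \<otimes> r))"
  have wv: "w \<in> carrier R" "v \<in> carrier R"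
    using c q r y by (auto simp: w_def v_def)
  have "v \<oplus> w \<otimes> v = q \<otimes> (((\<one> \<oplus> z \<otimes> (r \<otimes> q)) \<otimes> y) \<otimes> (z \<otimes> r))"
    using c q r y(1) by (simp add: w_def v_def m_assoc l_distr r_distr)
  hence e: "v \<oplus> w \<otimes> v = w"
    using y(2) c q r by (simp add: w_def)
  have "(\<one> \<oplus> w) \<otimes> (\<one> \<ominus> v) = \<one> \<oplus> w \<ominus> (v \<oplus> w \<otimes> v)"
    using wv by (simp add: minus_eq l_distr r_distr r_minus minus_add a_ac)
  also have "\<dots> = \<one>" unfolding e using wv by (simp add: minus_eq a_assoc r_neg)
  finally show "\<exists>u\<in>carrier R. (\<one> \<oplus> q \<otimes> z \<otimes> r) \<otimes> u = \<one>"
    using wv c q r by (intro bexI[of _ "\<one> \<ominus> v"]) (auto simp: w_def m_assoc)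
qed

text \<open>A proper right ideal contains no right invertible element, so all proper right ideals
  lie inside \<open>jac\<close>, which is itself proper.\<close>

lemma local_ringI:
  assumes "\<one> \<noteq> \<zero>"
    and inv: "\<And>x. x \<in> carrier R \<Longrightarrow> x \<notin> jac \<Longrightarrow> \<exists>u\<in>carrier R. x \<otimes> u = \<one>"
  shows "local_ring R"
proof -
  have proper: "J \<subseteq> jac" if "right_ideal J R" "J \<noteq> carrier R" for J
    using that right_idealI_one[OF that(1)] right_idealD(1)[OF that(1)] inv by blast
  have "\<one> \<notin> jac"
  proof
    assume "\<one> \<in> jac"
    then obtain u where "u \<in> carrier R" "(\<one> \<oplus> \<one> \<otimes> (\<ominus> \<one>)) \<otimes> u = \<one>"
      unfolding jac_def by blast
    thus False using assms(1) by (simp add: r_neg)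
  qed
  hence ne: "jac \<noteq> carrier R" by auto
  show ?thesis
    unfolding local_ring_def
  proof (rule ex1I[of _ jac])
    show "maximal_right_ideal jac R"
      unfolding maximal_right_ideal_def using jac_right_ideal ne proper by blast
    show "M = jac" if "maximal_right_ideal M R" for M
      using that proper[of M] jac_right_ideal ne unfolding maximal_right_ideal_def by blast
  qed
qed

lemma simple_ringI:
  assumes "\<zero> \<noteq> \<one>"
    and P: "\<And>x. x \<in> carrier R \<Longrightarrow> x \<noteq> \<zero> \<Longrightarrow> \<exists>u\<in>carrier R. \<exists>v\<in>carrier R. v \<otimes> x \<otimes> u = \<one>"
  shows "simple_ring R"
  unfolding simple_ring_def
proof (intro conjI allI impI assms(1))
  fix I assume "ideal I R"
  then interpret I: ideal I R .
  show "I = {\<zero>} \<or> I = carrier R"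
  proof (rule disjCI)
    assume "I \<noteq> carrier R"
    hence "\<one> \<notin> I" using I.one_imp_carrier by blast
    have "x = \<zero>" if x: "x \<in> I" for x
    proof (rule ccontr)
      assume "x \<noteq> \<zero>"
      then obtain u v where "u \<in> carrier R" "v \<in> carrier R" "v \<otimes> x \<otimes> u = \<one>"
        using P[OF I.Icarr[OF x]] by blast
      thus False
        using I.I_r_closed[OF I.I_l_closed[OF x], of v u] \<open>\<one> \<notin> I\<close> by simp
    qed
    thus "I = {\<zero>}" using I.zero_closed by blast
  qed
qed

text \<open>If \<open>v e u = 1\<close> then \<open>e R\<close> contains a copy of \<open>R\<close>, so one-sided inverses of \<open>R\<close> transfer to
  the corner \<open>e R e\<close>.\<close>
lemma type_III_criterion:
  assumes P: "\<And>x. x \<in> carrier R \<Longrightarrow> x \<noteq> \<zero> \<Longrightarrow> \<exists>u\<in>carrier R. \<exists>v\<in>carrier R. v \<otimes> x \<otimes> u = \<one>"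
    and y: "y \<in> carrier R" and z: "z \<in> carrier R" and zy: "z \<otimes> y = \<one>" and yz: "y \<otimes> z \<noteq> \<one>"
  shows "type_III R"
  unfolding type_III_def
proof (intro allI impI)
  fix e assume e: "directly_finite_idempotent R e"
  hence ec: "e \<in> carrier R" and ee: "e \<otimes> e = e"
    by (auto simp: directly_finite_idempotent_def idempotent_elem_def)
  show "e = \<zero>"
  proof (rule ccontr)
    assume "e \<noteq> \<zero>"
    then obtain u0 v0 where uv0: "u0 \<in> carrier R" "v0 \<in> carrier R" "v0 \<otimes> e \<otimes> u0 = \<one>"
      using P ec by blast
    define u v where "u = e \<otimes> u0" and "v = v0 \<otimes> e"
    have uc: "u \<in> carrier R" and vc: "v \<in> carrier R"
      using uv0 ec by (auto simp: u_def v_def)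
    have eu: "e \<otimes> u = u" and ve: "v \<otimes> e = v"
      using uv0 ec ee by (auto simp: u_def v_def m_assoc) (simp add: m_assoc[symmetric])
    have vu: "v \<otimes> u = \<one>"
      using uv0 ec ee by (simp add: u_def v_def m_assoc) (simp add: m_assoc[symmetric])
    have eu': "e \<otimes> (u \<otimes> x) = u \<otimes> x" and vu': "v \<otimes> (u \<otimes> x) = x"
      and zy': "z \<otimes> (y \<otimes> x) = x" and ee': "e \<otimes> (e \<otimes> x) = e \<otimes> x"
      if "x \<in> carrier R" for x
      using that ec uc vc y z eu vu zy ee by (simp_all add: m_assoc[symmetric])
    \<comment> \<open>\<open>u v\<close> is an idempotent below \<open>e\<close> whose corner is a
      copy of \<open>R\<close>; \<open>g\<close> is its complement inside \<open>e\<close>.\<close>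
    define g where "g = e \<ominus> u \<otimes> v"
    have gc: "g \<in> carrier R" using ec uc vc by (simp add: g_def)
    have vg: "v \<otimes> g = \<zero>" and gu: "g \<otimes> u = \<zero>"
      using ec uc vc eu ve vu
      by (simp_all add: g_def minus_eq r_distr l_distr r_minus l_minus m_assoc vu' r_neg)
    have eg: "e \<otimes> g = g" and ge: "g \<otimes> e = g"
      using ec uc vc eu ve ee
      by (simp_all add: g_def minus_eq r_distr l_distr r_minus l_minus m_assoc eu')
    have gg: "g \<otimes> g = g"
    proof -
      have "g \<otimes> g = g \<otimes> e \<ominus> g \<otimes> (u \<otimes> v)"
        using ec uc vc gc by (subst (2) g_def) (simp add: minus_eq r_distr r_minus)
      also have "g \<otimes> (u \<otimes> v) = \<zero>"
        using gu ec uc vc gc by (simp add: m_assoc[symmetric])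
      finally show ?thesis using ge gc by (simp add: minus_eq)
    qed
    have vg': "v \<otimes> (g \<otimes> x) = \<zero>" and gu': "g \<otimes> (u \<otimes> x) = \<zero>" if "x \<in> carrier R" for x
      using that vg gu gc uc vc by (simp_all add: m_assoc[symmetric])
    \<comment> \<open>\<open>Y\<close> and \<open>Z\<close> act like \<open>y\<close> and
      \<open>z\<close> on the copy of \<open>R\<close> and as the identity on the part cut out by
      \<open>g\<close>. Thus \<open>Z Y = e\<close>, while \<open>Y Z = e\<close> compressed between
      \<open>v\<close> and \<open>u\<close> would give \<open>y z = 1\<close>.\<close>
    define Y Z where "Y = u \<otimes> (y \<otimes> v) \<oplus> g" and "Z = u \<otimes> (z \<otimes> v) \<oplus> g"
    have YZc: "Y \<in> carrier R" "Z \<in> carrier R"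
      using uc vc y z gc by (auto simp: Y_def Z_def)
    have corner: "x \<in> carrier (corner_ring R e)" if "x \<in> carrier R" "e \<otimes> x = x" "x \<otimes> e = x" for x
      unfolding corner_ring_def using that ec by (auto intro!: exI[of _ x])
    have "e \<otimes> Y = Y" "Y \<otimes> e = Y" "e \<otimes> Z = Z" "Z \<otimes> e = Z"
      using uc vc y z gc ec eg ge ve
      by (simp_all add: Y_def Z_def r_distr l_distr m_assoc eu')
    hence inc: "Y \<in> carrier (corner_ring R e)" "Z \<in> carrier (corner_ring R e)"
      using corner YZc by blast+
    have "Z \<otimes> Y = u \<otimes> v \<oplus> g"
      using uc vc y z gc gg vg
      by (simp add: Y_def Z_def r_distr l_distr m_assoc vu' vg' gu' zy')
    also have uvg: "u \<otimes> v \<oplus> g = e"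
      using ec uc vc by (simp add: g_def minus_eq a_lcomm[of "u \<otimes> v" e] r_neg)
    finally have ZY: "Z \<otimes> Y = e" .
    have "\<forall>x\<in>carrier (corner_ring R e). \<forall>y\<in>carrier (corner_ring R e).
        x \<otimes> y = e \<longrightarrow> y \<otimes> x = e"
    proof -
      have "(\<otimes>\<^bsub>corner_ring R e\<^esub>) = (\<otimes>)" "\<one>\<^bsub>corner_ring R e\<^esub> = e"
        by (simp_all add: corner_ring_def)
      thus ?thesis
        using e unfolding directly_finite_idempotent_def directly_finite_def by metis
    qed
    hence "Y \<otimes> Z = e"
      using inc ZY by blast
    moreover have "Y \<otimes> Z = u \<otimes> (y \<otimes> (z \<otimes> v)) \<oplus> g"
      using uc vc y z gc gg vg
      by (simp add: Y_def Z_def r_distr l_distr m_assoc vu' vg' gu')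
    ultimately have "u \<otimes> (y \<otimes> (z \<otimes> v)) \<oplus> g = u \<otimes> v \<oplus> g" using uvg by simp
    hence "u \<otimes> (y \<otimes> (z \<otimes> v)) = u \<otimes> v"
      using uc vc y z gc by simp
    moreover have "y \<otimes> z = v \<otimes> (u \<otimes> (y \<otimes> (z \<otimes> v))) \<otimes> u"
      using uc vc y z vu by (simp add: vu' m_assoc)
    moreover have "v \<otimes> (u \<otimes> v) \<otimes> u = \<one>"
      using uc vc vu by (simp add: vu')
    ultimately have "y \<otimes> z = \<one>" by metis
    thus False using yz by contradiction
  qed
qed

end

section \<open>Noncommutative power series\<close>

text \<open>The Cauchy product: the coefficient at \<open>l\<close> sums \<open>F u\<close> times
  \<open>G w\<close> over all splittings \<open>l = u @ w\<close>. The recursion separates the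
  splitting with empty \<open>u\<close> and shifts \<open>F\<close> by the first letter, so
  identities follow by induction on the word with \<open>F\<close> arbitrary.\<close>

fun ser_mult :: "('a, 'm) ring_scheme \<Rightarrow> (nat list \<Rightarrow> 'a) \<Rightarrow> (nat list \<Rightarrow> 'a) \<Rightarrow> nat list \<Rightarrow> 'a" where
  "ser_mult R F G [] = F [] \<otimes>\<^bsub>R\<^esub> G []"
| "ser_mult R F G (x # l) = F [] \<otimes>\<^bsub>R\<^esub> G (x # l) \<oplus>\<^bsub>R\<^esub> ser_mult R (\<lambda>k. F (x # k)) G l"

definition ser_const :: "('a, 'm) ring_scheme \<Rightarrow> 'a \<Rightarrow> nat list \<Rightarrow> 'a" where
  "ser_const R a = (\<lambda>l. if l = [] then a else \<zero>\<^bsub>R\<^esub>)"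

text \<open>Formal power series over \<open>R\<close> in noncommuting variables \<open>X\<^sub>0, X\<^sub>1, \<dots>\<close> that commute with \<open>R\<close>;
  a list of indices stands for a word in the variables.\<close>
definition series_ring :: "('a, 'm) ring_scheme \<Rightarrow> (nat list \<Rightarrow> 'a) ring" where
  "series_ring R = \<lparr>carrier = {F. \<forall>l. F l \<in> carrier R}, monoid.mult = ser_mult R,
     one = ser_const R \<one>\<^bsub>R\<^esub>, ring.zero = (\<lambda>_. \<zero>\<^bsub>R\<^esub>), ring.add = (\<lambda>F G l. F l \<oplus>\<^bsub>R\<^esub> G l)\<rparr>"

definition ser_var :: "('a, 'm) ring_scheme \<Rightarrow> nat \<Rightarrow> nat list \<Rightarrow> 'a" where
  "ser_var R i = (\<lambda>l. if l = [i] then \<one>\<^bsub>R\<^esub> else \<zero>\<^bsub>R\<^esub>)"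

context ring
begin

lemma ser_mult_closed:
  "\<forall>l. F l \<in> carrier R \<Longrightarrow> \<forall>l. G l \<in> carrier R \<Longrightarrow> ser_mult R F G l \<in> carrier R"
  by (induction l arbitrary: F) auto

lemma ser_mult_zero_left: "\<forall>l. G l \<in> carrier R \<Longrightarrow> ser_mult R (\<lambda>_. \<zero>) G l = \<zero>"
  by (induction l) auto

lemma ser_mult_const:
  assumes "a \<in> carrier R" "\<forall>l. G l \<in> carrier R"
  shows "ser_mult R (ser_const R a) G l = a \<otimes> G l"
  using assms by (cases l) (auto simp: ser_const_def ser_mult_zero_left)

lemma ser_mult_smult_left:
  assumes "a \<in> carrier R" "\<forall>l. F l \<in> carrier R" "\<forall>l. G l \<in> carrier R"
  shows "ser_mult R (\<lambda>l. a \<otimes> F l) G l = a \<otimes> ser_mult R F G l"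
  using assms by (induction l arbitrary: F) (auto simp: m_assoc r_distr ser_mult_closed)

lemma ser_mult_add_left:
  assumes "\<forall>l. F l \<in> carrier R" "\<forall>l. G l \<in> carrier R" "\<forall>l. H l \<in> carrier R"
  shows "ser_mult R (\<lambda>l. F l \<oplus> G l) H l = ser_mult R F H l \<oplus> ser_mult R G H l"
  using assms
proof (induction l arbitrary: F G)
  case (Cons x l)
  have c: "ser_mult R (\<lambda>k. F (x # k)) H l \<in> carrier R" "ser_mult R (\<lambda>k. G (x # k)) H l \<in> carrier R"
    using Cons.prems by (auto intro!: ser_mult_closed)
  show ?case
    using Cons.prems c by (simp add: Cons.IH l_distr a_ac)
qed (auto simp: l_distr)

lemma ser_mult_add_right:
  assumes "\<forall>l. F l \<in> carrier R" "\<forall>l. G l \<in> carrier R" "\<forall>l. H l \<in> carrier R"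
  shows "ser_mult R F (\<lambda>l. G l \<oplus> H l) l = ser_mult R F G l \<oplus> ser_mult R F H l"
  using assms
proof (induction l arbitrary: F)
  case (Cons x l)
  have c: "ser_mult R (\<lambda>k. F (x # k)) G l \<in> carrier R" "ser_mult R (\<lambda>k. F (x # k)) H l \<in> carrier R"
    using Cons.prems by (auto intro!: ser_mult_closed)
  show ?case
    using Cons.prems c by (simp add: Cons.IH r_distr a_ac)
qed (auto simp: r_distr)

lemma ser_mult_assoc:
  assumes "\<forall>l. F l \<in> carrier R" "\<forall>l. G l \<in> carrier R" "\<forall>l. H l \<in> carrier R"
  shows "ser_mult R (ser_mult R F G) H l = ser_mult R F (ser_mult R G H) l"
  using assms
proof (induction l arbitrary: F)
  case (Cons x l)
  define F' G' where "F' = (\<lambda>k. F (x # k))" and "G' = (\<lambda>k. G (x # k))"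
  have F': "\<forall>l. F' l \<in> carrier R" and G': "\<forall>l. G' l \<in> carrier R"
    using Cons.prems by (auto simp: F'_def G'_def)
  note cl = ser_mult_closed[OF F' Cons.prems(2)] ser_mult_closed[OF G' Cons.prems(3)]
    ser_mult_closed[OF F' ser_mult_closed[OF Cons.prems(2,3), THEN allI]]
  \<comment> \<open>A product rule for the shift by \<open>x\<close>: the shift of
    \<open>F G\<close> is \<open>F []\<close> times \<open>G'\<close>, plus \<open>F' G\<close>. The
    second summand is handled by the induction hypothesis at \<open>F'\<close>.\<close>
  have "ser_mult R (\<lambda>k. ser_mult R F G (x # k)) H l
      = ser_mult R (\<lambda>k. F [] \<otimes> G' k \<oplus> ser_mult R F' G k) H l"
    by (simp add: F'_def G'_def)
  also have "\<dots> = ser_mult R (\<lambda>k. F [] \<otimes> G' k) H l \<oplus> ser_mult R (ser_mult R F' G) H l"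
    by (rule ser_mult_add_left) (use Cons.prems G' cl in auto)
  also have "ser_mult R (\<lambda>k. F [] \<otimes> G' k) H l = F [] \<otimes> ser_mult R G' H l"
    by (rule ser_mult_smult_left) (use Cons.prems G' in auto)
  also have "ser_mult R (ser_mult R F' G) H l = ser_mult R F' (ser_mult R G H) l"
    using Cons.IH[OF F' Cons.prems(2,3)] .
  finally have e: "ser_mult R (\<lambda>k. ser_mult R F G (x # k)) H l
      = F [] \<otimes> ser_mult R G' H l \<oplus> ser_mult R F' (ser_mult R G H) l" .
  have "ser_mult R (ser_mult R F G) H (x # l) = F [] \<otimes> G [] \<otimes> H (x # l)
      \<oplus> (F [] \<otimes> ser_mult R G' H l \<oplus> ser_mult R F' (ser_mult R G H) l)"
    unfolding ser_mult.simps(2)[of R "ser_mult R F G"] e by simp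
  also have "\<dots> = F [] \<otimes> (G [] \<otimes> H (x # l) \<oplus> ser_mult R G' H l) \<oplus> ser_mult R F' (ser_mult R G H) l"
    using Cons.prems cl by (simp add: m_assoc r_distr a_assoc)
  also have "\<dots> = ser_mult R F (ser_mult R G H) (x # l)"
    by (simp add: F'_def G'_def)
  finally show ?case .
qed (auto simp: m_assoc)

lemma ser_mult_one_right:
  assumes "\<forall>l. F l \<in> carrier R"
  shows "ser_mult R F (ser_const R \<one>) l = F l"
  using assms by (induction l arbitrary: F) (auto simp: ser_const_def)

lemma ser_const_closed: "a \<in> carrier R \<Longrightarrow> ser_const R a \<in> carrier (series_ring R)"
  by (auto simp: series_ring_def ser_const_def)

lemma ser_var_closed: "ser_var R i \<in> carrier (series_ring R)"
  by (auto simp: series_ring_def ser_var_def)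

lemma series_ring_ring: "ring (series_ring R)"
proof (rule ringI)
  show "abelian_group (series_ring R)"
  proof (rule abelian_groupI)
    show "\<exists>y\<in>carrier (series_ring R). y \<oplus>\<^bsub>series_ring R\<^esub> x = \<zero>\<^bsub>series_ring R\<^esub>"
      if "x \<in> carrier (series_ring R)" for x
      using that by (intro bexI[of _ "\<lambda>l. \<ominus> x l"]) (auto simp: series_ring_def l_neg)
  qed (auto simp: series_ring_def a_ac fun_eq_iff)
  show "monoid (series_ring R)"
    by (rule monoidI)
      (auto simp: series_ring_def fun_eq_iff ser_mult_closed ser_mult_assoc ser_mult_one_right
        ser_mult_const, auto simp: ser_const_def)
qed (auto simp: series_ring_def ser_mult_add_left ser_mult_add_right fun_eq_iff)

lemma ser_const_hom: "ser_const R \<in> ring_hom R (series_ring R)"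
proof (rule ring_hom_memI)
  fix a b assume "a \<in> carrier R" "b \<in> carrier R"
  thus "ser_const R (a \<otimes> b) = ser_const R a \<otimes>\<^bsub>series_ring R\<^esub> ser_const R b"
    using ser_const_closed[of b]
    by (auto simp: series_ring_def ser_mult_const fun_eq_iff) (auto simp: ser_const_def)
  show "ser_const R (a \<oplus> b) = ser_const R a \<oplus>\<^bsub>series_ring R\<^esub> ser_const R b"
    by (auto simp: series_ring_def ser_const_def fun_eq_iff)
qed (auto simp: ser_const_closed, auto simp: series_ring_def)

lemma ser_const_inj: "inj_on (ser_const R) (carrier R)"
  by (auto simp: inj_on_def ser_const_def fun_eq_iff split: if_splits)

lemma ser_mult_low:
  assumes "\<forall>l. F l \<in> carrier R" "\<forall>l. length l < n \<longrightarrow> G l = \<zero>" "length l < n"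
  shows "ser_mult R F G l = \<zero>"
  using assms by (induction l arbitrary: F) auto

text \<open>Any other splitting of \<open>u @ w\<close> has a left part shorter than
  \<open>u\<close> or a right part shorter than \<open>w\<close>, so a single product
  survives.\<close>

lemma ser_mult_lead:
  assumes "\<forall>l. F l \<in> carrier R" "\<forall>l. G l \<in> carrier R"
    and "\<forall>l. length l < length u \<longrightarrow> F l = \<zero>" "\<forall>l. length l < length w \<longrightarrow> G l = \<zero>"
  shows "ser_mult R F G (u @ w) = F u \<otimes> G w"
  using assms
proof (induction u arbitrary: F)
  case Nil
  show ?case
  proof (cases w)
    case (Cons x w')
    have "ser_mult R (\<lambda>k. F (x # k)) G w' = \<zero>"
      by (rule ser_mult_low[where n = "length w"]) (use Nil Cons in auto)
    thus ?thesis using Nil Cons by simp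
  qed auto
next
  case (Cons x u)
  have "ser_mult R (\<lambda>k. F (x # k)) G (u @ w) = F (x # u) \<otimes> G w"
    by (rule Cons.IH) (use Cons.prems in auto)
  thus ?case using Cons.prems by simp
qed

lemma ser_lowest:
  assumes "F \<noteq> (\<lambda>_. \<zero>)"
  obtains u where "F u \<noteq> \<zero>" "\<forall>l. length l < length u \<longrightarrow> F l = \<zero>"
proof -
  have "\<exists>u. F u \<noteq> \<zero>" using assms by auto
  from exists_least_iff[THEN iffD1, of "\<lambda>n. \<exists>u. length u = n \<and> F u \<noteq> \<zero>"] this
  show ?thesis using that by blast
qed

text \<open>The witness is \<open>\<Sum>\<^sub>k e\<^sub>k X\<^sub>k\<close>, where \<open>e\<close> enumerates the prime ring \<open>R\<close>.\<close>
lemma series_ring_strongly_prime: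
  assumes "countable (carrier R)"
    and prime: "\<And>x y. x \<in> carrier R \<Longrightarrow> y \<in> carrier R \<Longrightarrow> x \<noteq> \<zero> \<Longrightarrow> y \<noteq> \<zero> \<Longrightarrow>
      \<exists>r\<in>carrier R. x \<otimes> r \<otimes> y \<noteq> \<zero>"
  shows "\<exists>t\<in>carrier (series_ring R). \<forall>F\<in>carrier (series_ring R). \<forall>G\<in>carrier (series_ring R).
    F \<noteq> \<zero>\<^bsub>series_ring R\<^esub> \<longrightarrow> G \<noteq> \<zero>\<^bsub>series_ring R\<^esub> \<longrightarrow>
    F \<otimes>\<^bsub>series_ring R\<^esub> (t \<otimes>\<^bsub>series_ring R\<^esub> G) \<noteq> \<zero>\<^bsub>series_ring R\<^esub>"
proof -
  define e where "e = from_nat_into (carrier R)"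
  have ec: "e k \<in> carrier R" for k
    unfolding e_def using from_nat_into[of "carrier R" k] by blast
  have es: "\<exists>k. e k = r" if "r \<in> carrier R" for r
    unfolding e_def using from_nat_into_surj[OF assms(1) that] by blast
  define t where "t = (\<lambda>l. case l of [k] \<Rightarrow> e k | _ \<Rightarrow> \<zero>)"
  have tc: "\<forall>l. t l \<in> carrier R"
    using ec by (auto simp: t_def split: list.split)
  have "ser_mult R F (ser_mult R t G) \<noteq> (\<lambda>_. \<zero>)"
    if F: "\<forall>l. F l \<in> carrier R" "F \<noteq> (\<lambda>_. \<zero>)" and G: "\<forall>l. G l \<in> carrier R" "G \<noteq> (\<lambda>_. \<zero>)" for F G
  proof -
    obtain u where u: "F u \<noteq> \<zero>" "\<forall>l. length l < length u \<longrightarrow> F l = \<zero>"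
      using ser_lowest[OF F(2)] .
    obtain w where w: "G w \<noteq> \<zero>" "\<forall>l. length l < length w \<longrightarrow> G l = \<zero>"
      using ser_lowest[OF G(2)] .
    obtain k where k: "F u \<otimes> e k \<otimes> G w \<noteq> \<zero>"
      using prime[of "F u" "G w"] F(1) G(1) u(1) w(1) es by metis
    \<comment> \<open>\<open>t\<close> lives on one-letter words and \<open>G\<close> vanishes below
      degree \<open>length w\<close>, so \<open>t G\<close> vanishes below degree
      \<open>length w + 1\<close>; the leading-term rule then applies a second time.\<close>
    have low: "\<forall>l. length l < length ([k] @ w) \<longrightarrow> ser_mult R t G l = \<zero>"
    proof (intro allI impI)
      fix l :: "nat list" assume l: "length l < length ([k] @ w)"
      show "ser_mult R t G l = \<zero>"
      proof (cases l)
        case Nil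
        thus ?thesis using G(1) by (simp add: t_def)
      next
        case (Cons x l')
        have "ser_mult R (\<lambda>k. t (x # k)) G l' = \<zero>"
          by (rule ser_mult_low[where n = "length w"]) (use tc w l Cons in auto)
        thus ?thesis using G(1) Cons by (simp add: t_def)
      qed
    qed
    have "ser_mult R t G ([k] @ w) = t [k] \<otimes> G w"
      by (rule ser_mult_lead) (use tc G w in \<open>auto simp: t_def\<close>)
    moreover have "ser_mult R F (ser_mult R t G) (u @ ([k] @ w)) = F u \<otimes> ser_mult R t G ([k] @ w)"
      by (rule ser_mult_lead[OF F(1) _ u(2) low]) (use ser_mult_closed[OF tc G(1)] in auto)
    ultimately have "ser_mult R F (ser_mult R t G) (u @ ([k] @ w)) = F u \<otimes> e k \<otimes> G w"
      using F(1) G(1) ec by (simp add: t_def m_assoc)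
    thus ?thesis using k by auto
  qed
  thus ?thesis
    by (intro bexI[of _ t]) (use tc in \<open>auto simp: series_ring_def\<close>)
qed

text \<open>Left multiplication by a variable prepends its letter to every word.\<close>

lemma ser_mult_var:
  assumes "\<forall>l. F l \<in> carrier R"
  shows "ser_mult R (ser_var R i) F (j # l) = (if i = j then F l else \<zero>)"
proof -
  have "(\<lambda>k. ser_var R i (j # k)) = (if i = j then ser_const R \<one> else (\<lambda>_. \<zero>))"
    by (auto simp: ser_var_def ser_const_def)
  thus ?thesis
    using assms by (auto simp: ser_mult_const ser_mult_zero_left) (auto simp: ser_var_def)
qed

text \<open>Words with different first letters never cancel, so the right ideals generated by two
  variables meet in zero. This independence later keeps the image of a variable from being
  invertible in the quotient ring.\<close>

lemma series_var_cancel: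
  assumes "F \<in> carrier (series_ring R)" "G \<in> carrier (series_ring R)"
    and "ser_var R i \<otimes>\<^bsub>series_ring R\<^esub> F = ser_var R j \<otimes>\<^bsub>series_ring R\<^esub> G" "i \<noteq> j"
  shows "G = \<zero>\<^bsub>series_ring R\<^esub>"
proof
  fix l
  have "ser_mult R (ser_var R i) F (j # l) = ser_mult R (ser_var R j) G (j # l)"
    using assms(3) by (simp add: series_ring_def del: ser_mult.simps)
  thus "G l = \<zero>\<^bsub>series_ring R\<^esub> l"
    using assms(1,2,4) by (simp add: series_ring_def ser_mult_var del: ser_mult.simps)
qed

lemma series_var_inj:
  assumes "F \<in> carrier (series_ring R)"
    and "ser_var R i \<otimes>\<^bsub>series_ring R\<^esub> F = \<zero>\<^bsub>series_ring R\<^esub>"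
  shows "F = \<zero>\<^bsub>series_ring R\<^esub>"
proof
  fix l
  have "ser_mult R (ser_var R i) F (i # l) = \<zero>"
    using assms(2) by (simp add: series_ring_def del: ser_mult.simps)
  thus "F l = \<zero>\<^bsub>series_ring R\<^esub> l"
    using assms(1) by (simp add: series_ring_def ser_mult_var del: ser_mult.simps)
qed

end

section \<open>The maximal right quotient ring\<close>

context ring
begin

text \<open>Essential right ideals, tested on cyclic right ideals \<open>x R\<close>; this already
  forces a nonzero intersection with every nonzero right ideal.\<close>

definition ess :: "'a set \<Rightarrow> bool" where
  "ess E \<longleftrightarrow> right_ideal E R \<and>
     (\<forall>x\<in>carrier R. x \<noteq> \<zero> \<longrightarrow> (\<exists>s\<in>carrier R. x \<otimes> s \<in> E \<and> x \<otimes> s \<noteq> \<zero>))"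

lemma ess_right_ideal: "ess E \<Longrightarrow> right_ideal E R"
  by (simp add: ess_def)

lemma ess_subset: "ess E \<Longrightarrow> E \<subseteq> carrier R"
  using right_idealD(1) by (auto simp: ess_def)

lemma essE:
  assumes "ess E" "x \<in> carrier R" "x \<noteq> \<zero>"
  obtains s where "s \<in> carrier R" "x \<otimes> s \<in> E" "x \<otimes> s \<noteq> \<zero>"
  using assms by (auto simp: ess_def)

lemma ess_carrier: "ess (carrier R)"
  unfolding ess_def using right_ideal_carrier by (auto intro!: bexI[of _ \<one>])

lemma ess_Int:
  assumes "ess E" "ess F"
  shows "ess (E \<inter> F)"
  unfolding ess_def
proof (intro conjI ballI impI)
  show "right_ideal (E \<inter> F) R"
    using assms by (simp add: ess_def right_ideal_Int)
  fix x assume x: "x \<in> carrier R" "x \<noteq> \<zero>"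
  obtain s where s: "s \<in> carrier R" "x \<otimes> s \<in> E" "x \<otimes> s \<noteq> \<zero>"
    using essE[OF assms(1) x] .
  obtain r where r: "r \<in> carrier R" "x \<otimes> s \<otimes> r \<in> F" "x \<otimes> s \<otimes> r \<noteq> \<zero>"
    using essE[OF assms(2) _ s(3)] x s by auto
  have "x \<otimes> s \<otimes> r \<in> E"
    using right_idealD(4)[OF ess_right_ideal[OF assms(1)]] s r by blast
  thus "\<exists>s\<in>carrier R. x \<otimes> s \<in> E \<inter> F \<and> x \<otimes> s \<noteq> \<zero>"
    using x s r by (intro bexI[of _ "s \<otimes> r"]) (auto simp: m_assoc)
qed

text \<open>For nonzero \<open>y\<close> there are two cases. If \<open>x y = 0\<close>, then
  \<open>y\<close> itself lies in the preimage; otherwise a nonzero multiple \<open>x y s\<close> in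
  \<open>E\<close> works, and \<open>y s\<close> cannot vanish.\<close>

lemma ess_preimage:
  assumes "ess E" "x \<in> carrier R"
  shows "ess {s \<in> carrier R. x \<otimes> s \<in> E}"
  unfolding ess_def
proof (intro conjI ballI impI)
  note I = right_idealD[OF ess_right_ideal[OF assms(1)]]
  show "right_ideal {s \<in> carrier R. x \<otimes> s \<in> E} R"
    by (rule right_idealI) (use I assms(2) in \<open>auto simp: r_distr m_assoc[symmetric]\<close>)
  fix y assume y: "y \<in> carrier R" "y \<noteq> \<zero>"
  show "\<exists>s\<in>carrier R. y \<otimes> s \<in> {s \<in> carrier R. x \<otimes> s \<in> E} \<and> y \<otimes> s \<noteq> \<zero>"
  proof (cases "x \<otimes> y = \<zero>")
    case True
    thus ?thesis using y I(2) by (intro bexI[of _ \<one>]) auto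
  next
    case False
    then obtain s where s: "s \<in> carrier R" "x \<otimes> y \<otimes> s \<in> E" "x \<otimes> y \<otimes> s \<noteq> \<zero>"
      using essE[OF assms(1), of "x \<otimes> y"] assms(2) y by auto
    moreover have "y \<otimes> s \<noteq> \<zero>"
      using s assms(2) y by (auto simp: m_assoc)
    ultimately show ?thesis using y assms(2) by (auto simp: m_assoc)
  qed
qed

text \<open>Zorn's lemma gives \<open>C\<close> maximal with
  \<open>I \<inter> C = {\<zero>}\<close>. If some nonzero \<open>x R\<close> met
  \<open>I + C\<close> only in zero, then \<open>C + x R\<close> would still meet \<open>I\<close>
  trivially, against maximality.\<close>

lemma ex_complement:
  assumes I: "right_ideal I R"
  shows "\<exists>C. right_ideal C R \<and> I \<inter> C = {\<zero>} \<and> ess {x \<oplus> y |x y. x \<in> I \<and> y \<in> C}"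
proof -
  note I' = right_idealD[OF I]
  define A where "A = {J. right_ideal J R \<and> I \<inter> J = {\<zero>}}"
  have "\<exists>M\<in>A. \<forall>L\<in>A. M \<subseteq> L \<longrightarrow> L = M"
  proof (rule subset_Zorn_nonempty)
    have "{\<zero>} \<in> A"
      unfolding A_def using I' by (auto intro!: right_idealI)
    thus "A \<noteq> {}" by blast
  next
    fix \<C> assume ne: "\<C> \<noteq> {}" and ch: "subset.chain A \<C>"
    have J: "right_ideal J R" "I \<inter> J = {\<zero>}" if "J \<in> \<C>" for J
      using ch that by (auto simp: subset_chain_def A_def)
    have "right_ideal (\<Union>\<C>) R"
    proof (rule right_idealI)
      show "\<Union>\<C> \<subseteq> carrier R" using right_idealD(1)[OF J(1)] by blast
      show "\<zero> \<in> \<Union>\<C>" using ne right_idealD(2)[OF J(1)] by blast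
      show "x \<otimes> r \<in> \<Union>\<C>" if "x \<in> \<Union>\<C>" "r \<in> carrier R" for x r
        using that right_idealD(4)[OF J(1)] by blast
      fix x y assume "x \<in> \<Union>\<C>" "y \<in> \<Union>\<C>"
      then obtain L Y where XY: "L \<in> \<C>" "Y \<in> \<C>" "x \<in> L" "y \<in> Y" by blast
      then obtain Z where "Z \<in> \<C>" "x \<in> Z" "y \<in> Z"
        using ch unfolding subset_chain_def by blast
      thus "x \<oplus> y \<in> \<Union>\<C>" using right_idealD(3)[OF J(1)] by blast
    qed
    moreover have "I \<inter> \<Union>\<C> = {\<zero>}"
      using J(2) ne by blast
    ultimately show "\<Union>\<C> \<in> A" unfolding A_def by (intro CollectI conjI)
  qed
  then obtain C where CA: "C \<in> A" and CM: "\<forall>L\<in>A. C \<subseteq> L \<longrightarrow> L = C" by blast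
  have C: "right_ideal C R" "I \<inter> C = {\<zero>}"
    using CA unfolding A_def by blast+
  have max: "L = C" if "right_ideal L R" "I \<inter> L = {\<zero>}" "C \<subseteq> L" for L
  proof -
    have "L \<in> A" unfolding A_def using that(1,2) by (intro CollectI conjI)
    thus ?thesis using CM that(3) by blast
  qed
  note C' = right_idealD[OF C(1)]
  have sum: "right_ideal {x \<oplus> y |x y. x \<in> J \<and> y \<in> K} R"
    if J: "right_ideal J R" and K: "right_ideal K R" for J K
  proof (rule right_idealI)
    note J' = right_idealD[OF J] and K' = right_idealD[OF K]
    show "{x \<oplus> y |x y. x \<in> J \<and> y \<in> K} \<subseteq> carrier R"
      using J'(1) K'(1) by auto
    show "\<zero> \<in> {x \<oplus> y |x y. x \<in> J \<and> y \<in> K}"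
      using J'(2) K'(2) by (auto intro!: exI[of _ \<zero>])
    show "a \<otimes> r \<in> {x \<oplus> y |x y. x \<in> J \<and> y \<in> K}"
      if "a \<in> {x \<oplus> y |x y. x \<in> J \<and> y \<in> K}" "r \<in> carrier R" for a r
    proof -
      obtain x y where xy: "a = x \<oplus> y" "x \<in> J" "y \<in> K" using \<open>a \<in> _\<close> by blast
      hence "a \<otimes> r = x \<otimes> r \<oplus> y \<otimes> r"
        using J'(1) K'(1) that by (auto intro: l_distr)
      thus ?thesis using xy J'(4) K'(4) that by blast
    qed
    show "a \<oplus> b \<in> {x \<oplus> y |x y. x \<in> J \<and> y \<in> K}"
      if "a \<in> {x \<oplus> y |x y. x \<in> J \<and> y \<in> K}" "b \<in> {x \<oplus> y |x y. x \<in> J \<and> y \<in> K}" for a b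
    proof -
      obtain x y where xy: "a = x \<oplus> y" "x \<in> J" "y \<in> K" using \<open>a \<in> _\<close> by blast
      obtain x' y' where xy': "b = x' \<oplus> y'" "x' \<in> J" "y' \<in> K" using \<open>b \<in> _\<close> by blast
      have c: "x \<in> carrier R" "y \<in> carrier R" "x' \<in> carrier R" "y' \<in> carrier R"
        using xy xy' J'(1) K'(1) by auto
      hence "a \<oplus> b = (x \<oplus> x') \<oplus> (y \<oplus> y')" using xy xy' by (simp add: a_ac)
      thus ?thesis using xy xy' J'(3) K'(3) by blast
    qed
  qed
  have "ess {x \<oplus> y |x y. x \<in> I \<and> y \<in> C}"
    unfolding ess_def
  proof (intro conjI ballI impI sum I C(1))
    fix x assume x: "x \<in> carrier R" "x \<noteq> \<zero>"
    show "\<exists>s\<in>carrier R. x \<otimes> s \<in> {x \<oplus> y |x y. x \<in> I \<and> y \<in> C} \<and> x \<otimes> s \<noteq> \<zero>"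
    proof (rule ccontr)
      assume "\<not> ?thesis"
      hence nz: "x \<otimes> s = \<zero>" if "s \<in> carrier R" "x \<otimes> s = i \<oplus> c" "i \<in> I" "c \<in> C" for s i c
        using that by blast
      define D where "D = {c \<oplus> w |c w. c \<in> C \<and> w \<in> {x \<otimes> s |s. s \<in> carrier R}}"
      have D: "right_ideal D R"
        unfolding D_def by (intro sum C(1) right_ideal_principal x(1))
      have "C \<subseteq> D"
      proof
        fix c assume "c \<in> C"
        hence "c = c \<oplus> x \<otimes> \<zero>" using C'(1) x(1) by auto
        thus "c \<in> D" unfolding D_def using \<open>c \<in> C\<close> by blast
      qed
      moreover have "I \<inter> D \<subseteq> {\<zero>}"
      proof
        fix i assume i: "i \<in> I \<inter> D"
        then obtain c s where cs: "c \<in> C" "s \<in> carrier R" "i = c \<oplus> x \<otimes> s"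
          by (auto simp: D_def)
        have cc: "i \<in> carrier R" "c \<in> carrier R" using i cs I'(1) C'(1) by auto
        \<comment> \<open>Hence \<open>x s\<close> lies in \<open>I + C\<close> and vanishes by
          \<open>nz\<close>, so that \<open>i = c\<close> falls into
          \<open>I \<inter> C\<close>.\<close>
        have "i \<oplus> \<ominus> c = x \<otimes> s"
          unfolding cs(3) using cc(2) x(1) cs(2)
          by (simp add: a_assoc a_comm[of "x \<otimes> s" "\<ominus> c"]) (simp add: a_assoc[symmetric] r_neg)
        hence "x \<otimes> s = \<zero>"
          using nz[OF cs(2), of i "\<ominus> c"] i C'(5)[OF cs(1)] by auto
        hence "i \<in> I \<inter> C" using cs cc i by simp
        thus "i \<in> {\<zero>}" using C(2) by simp
      qed
      ultimately have "D = C"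
        using max[OF D] right_idealD(2)[OF D] I'(2) by blast
      have "x = \<zero> \<oplus> x \<otimes> \<one>" using x by simp
      hence "x \<in> D" unfolding D_def using C'(2) by blast
      hence "x \<otimes> \<one> = \<zero>"
        using nz[of \<one> \<zero> x] x(1) I'(2) \<open>D = C\<close> by simp
      thus False using x by simp
    qed
  qed
  with C show ?thesis by (intro exI[of _ C] conjI)
qed

text \<open>Graphs of right linear maps from essential right ideals to \<open>R\<close>. A relation
  carries its domain with it, and by additivity single-valuedness need only be required over
  \<open>\<zero>\<close> (compare \<open>pmap_fun\<close>).\<close>

definition pmap :: "('a \<times> 'a) set \<Rightarrow> bool" where
  "pmap g \<longleftrightarrow> g \<subseteq> carrier R \<times> carrier R \<and> (\<zero>, \<zero>) \<in> g \<and>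
     (\<forall>x y x' y'. (x, y) \<in> g \<longrightarrow> (x', y') \<in> g \<longrightarrow> (x \<oplus> x', y \<oplus> y') \<in> g) \<and>
     (\<forall>x y s. (x, y) \<in> g \<longrightarrow> s \<in> carrier R \<longrightarrow> (x \<otimes> s, y \<otimes> s) \<in> g) \<and>
     (\<forall>y. (\<zero>, y) \<in> g \<longrightarrow> y = \<zero>) \<and>
     (\<forall>x\<in>carrier R. x \<noteq> \<zero> \<longrightarrow> (\<exists>s\<in>carrier R. x \<otimes> s \<in> Domain g \<and> x \<otimes> s \<noteq> \<zero>))"

lemma pmapI:
  assumes "\<And>x y. (x, y) \<in> g \<Longrightarrow> x \<in> carrier R \<and> y \<in> carrier R" "(\<zero>, \<zero>) \<in> g"
    and "\<And>x y x' y'. (x, y) \<in> g \<Longrightarrow> (x', y') \<in> g \<Longrightarrow> (x \<oplus> x', y \<oplus> y') \<in> g"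
    and "\<And>x y s. (x, y) \<in> g \<Longrightarrow> s \<in> carrier R \<Longrightarrow> (x \<otimes> s, y \<otimes> s) \<in> g"
    and "\<And>y. (\<zero>, y) \<in> g \<Longrightarrow> y = \<zero>"
    and "\<And>x. x \<in> carrier R \<Longrightarrow> x \<noteq> \<zero> \<Longrightarrow> \<exists>s\<in>carrier R. x \<otimes> s \<in> Domain g \<and> x \<otimes> s \<noteq> \<zero>"
  shows "pmap g"
  unfolding pmap_def
proof (intro conjI allI impI ballI)
  show "g \<subseteq> carrier R \<times> carrier R" using assms(1) by auto
qed (rule assms; assumption)+

lemma pmapD:
  assumes "pmap g"
  shows "\<And>x y. (x, y) \<in> g \<Longrightarrow> x \<in> carrier R" "\<And>x y. (x, y) \<in> g \<Longrightarrow> y \<in> carrier R"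
    and "(\<zero>, \<zero>) \<in> g"
    and "\<And>x y x' y'. (x, y) \<in> g \<Longrightarrow> (x', y') \<in> g \<Longrightarrow> (x \<oplus> x', y \<oplus> y') \<in> g"
    and "\<And>x y s. (x, y) \<in> g \<Longrightarrow> s \<in> carrier R \<Longrightarrow> (x \<otimes> s, y \<otimes> s) \<in> g"
    and "\<And>y. (\<zero>, y) \<in> g \<Longrightarrow> y = \<zero>"
    and "\<And>x. x \<in> carrier R \<Longrightarrow> x \<noteq> \<zero> \<Longrightarrow> \<exists>s\<in>carrier R. x \<otimes> s \<in> Domain g \<and> x \<otimes> s \<noteq> \<zero>"
proof -
  note D = assms[unfolded pmap_def]
  note D1 = D[THEN conjunct1]
    and D2 = D[THEN conjunct2, THEN conjunct1]
    and D3 = D[THEN conjunct2, THEN conjunct2, THEN conjunct1, rule_format]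
    and D4 = D[THEN conjunct2, THEN conjunct2, THEN conjunct2, THEN conjunct1, rule_format]
    and D5 = D[THEN conjunct2, THEN conjunct2, THEN conjunct2, THEN conjunct2, THEN conjunct1,
      rule_format]
    and D6 = D[THEN conjunct2, THEN conjunct2, THEN conjunct2, THEN conjunct2, THEN conjunct2,
      rule_format]
  show "x \<in> carrier R" "y \<in> carrier R" if "(x, y) \<in> g" for x y
    using D1 that by auto
  show "(\<zero>, \<zero>) \<in> g" by (rule D2)
  show "(x \<oplus> x', y \<oplus> y') \<in> g" if "(x, y) \<in> g" "(x', y') \<in> g" for x y x' y'
    by (rule D3[OF that])
  show "(x \<otimes> s, y \<otimes> s) \<in> g" if "(x, y) \<in> g" "s \<in> carrier R" for x y s
    by (rule D4[OF that])
  show "y = \<zero>" if "(\<zero>, y) \<in> g" for y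
    by (rule D5[OF that])
  show "\<exists>s\<in>carrier R. x \<otimes> s \<in> Domain g \<and> x \<otimes> s \<noteq> \<zero>" if "x \<in> carrier R" "x \<noteq> \<zero>" for x
    by (rule D6[OF that])
qed

lemma pmap_fun:
  assumes "pmap g" "(x, y) \<in> g" "(x, y') \<in> g"
  shows "y = y'"
proof -
  note D = pmapD[OF assms(1)]
  have c: "x \<in> carrier R" "y \<in> carrier R" "y' \<in> carrier R"
    using D(1,2) assms by blast+
  have "(x \<oplus> x \<otimes> \<ominus> \<one>, y \<oplus> y' \<otimes> \<ominus> \<one>) \<in> g"
    by (rule D(4)[OF assms(2) D(5)[OF assms(3)]]) simp
  hence "(\<zero>, y \<ominus> y') \<in> g"
    using c by (simp add: r_minus minus_eq r_neg)
  hence "y \<ominus> y' = \<zero>" by (rule D(6))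
  thus ?thesis using c by simp
qed

lemma pmap_Domain:
  assumes "pmap g"
  shows "ess (Domain g)"
proof -
  note D = pmapD[OF assms]
  have "right_ideal (Domain g) R"
  proof (rule right_idealI)
    show "Domain g \<subseteq> carrier R" using D(1) by blast
    show "\<zero> \<in> Domain g" using D(3) by blast
    show "x \<oplus> y \<in> Domain g" if "x \<in> Domain g" "y \<in> Domain g" for x y
      using that D(4) by blast
    show "x \<otimes> r \<in> Domain g" if "x \<in> Domain g" "r \<in> carrier R" for x r
      using that D(5) by blast
  qed
  thus ?thesis using D(7) by (auto simp: ess_def)
qed

text \<open>\<open>q O p\<close> applies \<open>q\<close> first, hence the reversed order in the
  product of \<open>max_quot\<close>. For the essential domain: where \<open>q\<close> has value
  zero the composite is already defined; otherwise the value is multiplied into the domain of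
  \<open>p\<close>, and its being nonzero keeps the argument nonzero.\<close>

lemma pmap_relcomp:
  assumes p: "pmap p" and q: "pmap q"
  shows "pmap (q O p)"
proof (rule pmapI)
  note P = pmapD[OF p] and Q = pmapD[OF q]
  show "x \<in> carrier R \<and> y \<in> carrier R" if "(x, y) \<in> q O p" for x y
    using that P(2) Q(1) by blast
  show "(\<zero>, \<zero>) \<in> q O p" using P(3) Q(3) by blast
  show "(x \<oplus> x', y \<oplus> y') \<in> q O p" if "(x, y) \<in> q O p" "(x', y') \<in> q O p" for x y x' y'
    using that P(4) Q(4) by (meson relcomp.cases relcomp.relcompI relcompE)
  show "(x \<otimes> s, y \<otimes> s) \<in> q O p" if "(x, y) \<in> q O p" "s \<in> carrier R" for x y s
    using that P(5) Q(5) by blast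
  show "y = \<zero>" if "(\<zero>, y) \<in> q O p" for y
    using that P(6) Q(6) by blast
  fix x assume x: "x \<in> carrier R" "x \<noteq> \<zero>"
  obtain s y where s: "s \<in> carrier R" "(x \<otimes> s, y) \<in> q" "x \<otimes> s \<noteq> \<zero>"
    using Q(7)[OF x] by blast
  show "\<exists>s\<in>carrier R. x \<otimes> s \<in> Domain (q O p) \<and> x \<otimes> s \<noteq> \<zero>"
  proof (cases "y = \<zero>")
    case True
    thus ?thesis using s P(3) by blast
  next
    case False
    then obtain r z where r: "r \<in> carrier R" "(y \<otimes> r, z) \<in> p" "y \<otimes> r \<noteq> \<zero>"
      using P(7)[of y] Q(2)[OF s(2)] by blast
    have m: "(x \<otimes> (s \<otimes> r), y \<otimes> r) \<in> q"
      using Q(5)[OF s(2) r(1)] x s r by (simp add: m_assoc)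
    hence "x \<otimes> (s \<otimes> r) \<noteq> \<zero>" using Q(6) r(3) by metis
    thus ?thesis using m r s(1) by blast
  qed
qed

definition padd :: "('a \<times> 'a) set \<Rightarrow> ('a \<times> 'a) set \<Rightarrow> ('a \<times> 'a) set" where
  "padd p q = {(x, y \<oplus> z) |x y z. (x, y) \<in> p \<and> (x, z) \<in> q}"

lemma pmap_padd:
  assumes p: "pmap p" and q: "pmap q"
  shows "pmap (padd p q)"
proof (rule pmapI)
  note P = pmapD[OF p] and Q = pmapD[OF q]
  show "x \<in> carrier R \<and> y \<in> carrier R" if "(x, y) \<in> padd p q" for x y
    using that P(1,2) Q(1,2) by (auto simp: padd_def)
  have "(\<zero>, \<zero> \<oplus> \<zero>) \<in> padd p q" using P(3) Q(3) unfolding padd_def by blast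
  thus "(\<zero>, \<zero>) \<in> padd p q" by simp
  show "(x \<oplus> x', y \<oplus> y') \<in> padd p q" if xy: "(x, y) \<in> padd p q" "(x', y') \<in> padd p q" for x y x' y'
  proof -
    obtain a b where ab: "y = a \<oplus> b" "(x, a) \<in> p" "(x, b) \<in> q" using xy(1) by (auto simp: padd_def)
    obtain a' b' where ab': "y' = a' \<oplus> b'" "(x', a') \<in> p" "(x', b') \<in> q"
      using xy(2) by (auto simp: padd_def)
    have "y \<oplus> y' = (a \<oplus> a') \<oplus> (b \<oplus> b')"
      using ab ab' P(2) Q(2) by (metis a_assoc a_closed a_lcomm)
    thus ?thesis using P(4)[OF ab(2) ab'(2)] Q(4)[OF ab(3) ab'(3)] unfolding padd_def by blast
  qed
  show "(x \<otimes> s, y \<otimes> s) \<in> padd p q" if xy: "(x, y) \<in> padd p q" "s \<in> carrier R" for x y s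
  proof -
    obtain a b where ab: "y = a \<oplus> b" "(x, a) \<in> p" "(x, b) \<in> q" using xy(1) by (auto simp: padd_def)
    have "y \<otimes> s = a \<otimes> s \<oplus> b \<otimes> s" using ab P(2) Q(2) xy(2) by (metis l_distr)
    thus ?thesis using P(5)[OF ab(2) xy(2)] Q(5)[OF ab(3) xy(2)] unfolding padd_def by blast
  qed
  show "y = \<zero>" if "(\<zero>, y) \<in> padd p q" for y
    using that P(6) Q(6) by (force simp: padd_def)
  have "Domain (padd p q) = Domain p \<inter> Domain q"
    by (auto simp: padd_def)
  thus "\<exists>s\<in>carrier R. x \<otimes> s \<in> Domain (padd p q) \<and> x \<otimes> s \<noteq> \<zero>"
    if "x \<in> carrier R" "x \<noteq> \<zero>" for x
    using ess_Int[OF pmap_Domain[OF p] pmap_Domain[OF q]] that by (auto simp: ess_def)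
qed

definition lmul :: "'a \<Rightarrow> ('a \<times> 'a) set" where
  "lmul s = {(x, s \<otimes> x) |x. x \<in> carrier R}"

lemma pmap_lmul: "s \<in> carrier R \<Longrightarrow> pmap (lmul s)"
  by (rule pmapI) (auto simp: lmul_def r_distr m_assoc intro!: bexI[of _ \<one>] DomainI)

text \<open>Over a nonsingular ring this is the largest partial map extending \<open>g\<close>
  (\<open>pmap_pcl\<close>, \<open>pcl_maximal\<close>). It serves as a canonical representative of
  all partial maps that agree on an essential right ideal, in place of equivalence classes.\<close>

definition pcl :: "('a \<times> 'a) set \<Rightarrow> ('a \<times> 'a) set" where
  "pcl g = {(x, y). x \<in> carrier R \<and> y \<in> carrier R \<and>
     (\<exists>E. ess E \<and> (\<forall>e\<in>E. (x \<otimes> e, y \<otimes> e) \<in> g))}"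

lemma pcl_mono: "g \<subseteq> h \<Longrightarrow> pcl g \<subseteq> pcl h"
  unfolding pcl_def by blast

lemma pcl_extensive: "pmap g \<Longrightarrow> g \<subseteq> pcl g"
  unfolding pcl_def using pmapD(1,2,5)[of g] ess_carrier by blast

text \<open>For \<open>(x, y) \<in> p\<close> the elements \<open>e\<close> with \<open>x e\<close>
  in the domain of \<open>g\<close> form an essential right ideal, and single-valuedness of
  \<open>p\<close> forces \<open>g\<close> to take the value \<open>y e\<close> at
  \<open>x e\<close>.\<close>

lemma pcl_maximal:
  assumes "pmap p" "pmap g" "g \<subseteq> p"
  shows "p \<subseteq> pcl g"
proof
  fix z assume "z \<in> p"
  then obtain x y where xy: "z = (x, y)" "(x, y) \<in> p" by (cases z) auto
  note P = pmapD[OF assms(1)]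
  have xc: "x \<in> carrier R" using P(1) xy by blast
  have "(x \<otimes> e, y \<otimes> e) \<in> g" if e: "e \<in> {e \<in> carrier R. x \<otimes> e \<in> Domain g}" for e
  proof -
    obtain w where w: "(x \<otimes> e, w) \<in> g" using e by blast
    have "y \<otimes> e = w"
      by (rule pmap_fun[OF assms(1), of "x \<otimes> e"]) (use P(5) xy w e assms(3) in auto)
    thus ?thesis using w by simp
  qed
  thus "z \<in> pcl g"
    unfolding pcl_def xy(1) using xc P(2)[OF xy(2)] ess_preimage[OF pmap_Domain[OF assms(2)] xc]
    by blast
qed

text \<open>Elements of the maximal right quotient ring are the right \<open>R\<close>-linear maps from essential right
  ideals to \<open>R\<close> that have no proper extension, represented by their graphs; multiplication is
  composition.\<close>
definition max_quot :: "('a \<times> 'a) set ring" where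
  "max_quot = \<lparr>carrier = {p. pmap p \<and> pcl p = p}, monoid.mult = (\<lambda>p q. pcl (q O p)),
     one = lmul \<one>, ring.zero = lmul \<zero>, ring.add = (\<lambda>p q. pcl (padd p q))\<rparr>"

end

text \<open>Vanishing of the right singular ideal. This is what keeps the closure \<open>pcl\<close>
  single-valued.\<close>

locale nonsingular_ring = ring +
  assumes nonsingular: "ess E \<Longrightarrow> x \<in> carrier R \<Longrightarrow> (\<And>e. e \<in> E \<Longrightarrow> x \<otimes> e = \<zero>) \<Longrightarrow> x = \<zero>"
begin

lemma pmap_pcl:
  assumes g: "pmap g"
  shows "pmap (pcl g)"
proof (rule pmapI)
  note G = pmapD[OF g]
  show "x \<in> carrier R \<and> y \<in> carrier R" if "(x, y) \<in> pcl g" for x y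
    using that by (simp add: pcl_def)
  show "(\<zero>, \<zero>) \<in> pcl g" using G(3) pcl_extensive[OF g] by blast
  show "(x \<oplus> x', y \<oplus> y') \<in> pcl g" if xy: "(x, y) \<in> pcl g" "(x', y') \<in> pcl g" for x y x' y'
  proof -
    obtain E where E: "ess E" "\<forall>e\<in>E. (x \<otimes> e, y \<otimes> e) \<in> g" using xy(1) by (auto simp: pcl_def)
    obtain F where F: "ess F" "\<forall>e\<in>F. (x' \<otimes> e, y' \<otimes> e) \<in> g" using xy(2) by (auto simp: pcl_def)
    have c: "x \<in> carrier R" "y \<in> carrier R" "x' \<in> carrier R" "y' \<in> carrier R"
      using xy by (auto simp: pcl_def)
    have "((x \<oplus> x') \<otimes> e, (y \<oplus> y') \<otimes> e) \<in> g" if "e \<in> E \<inter> F" for e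
      using G(4)[of "x \<otimes> e" "y \<otimes> e" "x' \<otimes> e" "y' \<otimes> e"] that E F c ess_subset[OF E(1)]
      by (auto simp: l_distr subset_iff)
    thus ?thesis
      unfolding pcl_def using c ess_Int[OF E(1) F(1)] by blast
  qed
  show "(x \<otimes> s, y \<otimes> s) \<in> pcl g" if xy: "(x, y) \<in> pcl g" "s \<in> carrier R" for x y s
  proof -
    obtain E where E: "ess E" "\<forall>e\<in>E. (x \<otimes> e, y \<otimes> e) \<in> g" using xy(1) by (auto simp: pcl_def)
    have c: "x \<in> carrier R" "y \<in> carrier R"
      using xy by (auto simp: pcl_def)
    have "(x \<otimes> s \<otimes> e, y \<otimes> s \<otimes> e) \<in> g" if "e \<in> {e \<in> carrier R. s \<otimes> e \<in> E}" for e
      using E(2) that c xy(2) by (auto simp: m_assoc)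
    thus ?thesis
      unfolding pcl_def using c xy(2) ess_preimage[OF E(1) xy(2)] by blast
  qed
  show "y = \<zero>" if y: "(\<zero>, y) \<in> pcl g" for y
  proof -
    obtain E where E: "ess E" "\<forall>e\<in>E. (\<zero> \<otimes> e, y \<otimes> e) \<in> g" using y by (auto simp: pcl_def)
    have "y \<otimes> e = \<zero>" if "e \<in> E" for e
      using E that ess_subset[OF E(1)] G(6)[of "y \<otimes> e"] by (auto simp: subset_iff)
    thus ?thesis using nonsingular[OF E(1)] y by (auto simp: pcl_def)
  qed
  show "\<exists>s\<in>carrier R. x \<otimes> s \<in> Domain (pcl g) \<and> x \<otimes> s \<noteq> \<zero>" if "x \<in> carrier R" "x \<noteq> \<zero>" for x
    using G(7)[OF that] pcl_extensive[OF g] by blast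
qed

lemma pcl_pcl:
  assumes g: "pmap g"
  shows "pcl (pcl g) = pcl g"
proof
  note 1 = pmap_pcl[OF g]
  show "pcl g \<subseteq> pcl (pcl g)" by (rule pcl_extensive[OF 1])
  have "g \<subseteq> pcl (pcl g)"
    using pcl_extensive[OF g] pcl_extensive[OF 1] by blast
  thus "pcl (pcl g) \<subseteq> pcl g"
    by (rule pcl_maximal[OF pmap_pcl[OF 1] g])
qed

section \<open>The ring of maximal partial homomorphisms\<close>

lemma pcl_in_max_quot: "pmap g \<Longrightarrow> pcl g \<in> carrier max_quot"
  by (simp add: max_quot_def pmap_pcl pcl_pcl)

lemma max_quotD: "p \<in> carrier max_quot \<Longrightarrow> pmap p" "p \<in> carrier max_quot \<Longrightarrow> pcl p = p"
  by (auto simp: max_quot_def)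

text \<open>Both elements equal \<open>pcl g\<close>. Ring identities thereby reduce to inclusions
  of one common restriction in both sides, without computing any closure.\<close>

lemma max_quot_eqI:
  assumes "p \<in> carrier max_quot" "q \<in> carrier max_quot" "pmap g" "g \<subseteq> p" "g \<subseteq> q"
  shows "p = q"
proof -
  have "r = pcl g" if "r \<in> carrier max_quot" "g \<subseteq> r" for r
    using pcl_maximal[OF max_quotD(1)[OF that(1)] assms(3) that(2)] pcl_mono[OF that(2)]
      max_quotD(2)[OF that(1)] by blast
  thus ?thesis using assms by blast
qed

text \<open>\<open>lmul s\<close> is defined on all of \<open>R\<close> and its closure is
  single-valued, so there is no room for a proper extension.\<close>

lemma pcl_lmul:
  assumes "s \<in> carrier R"
  shows "pcl (lmul s) = lmul s"
proof
  note p = pmap_lmul[OF assms]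
  show "lmul s \<subseteq> pcl (lmul s)" by (rule pcl_extensive[OF p])
  show "pcl (lmul s) \<subseteq> lmul s"
  proof
    fix z assume z: "z \<in> pcl (lmul s)"
    then obtain x y where xy: "z = (x, y)" "x \<in> carrier R" by (auto simp: pcl_def)
    hence "(x, s \<otimes> x) \<in> lmul s" by (auto simp: lmul_def)
    moreover from this have "s \<otimes> x = y"
      using pmap_fun[OF pmap_pcl[OF p]] pcl_extensive[OF p] z xy by blast
    ultimately show "z \<in> lmul s" using xy by simp
  qed
qed

lemma lmul_in_max_quot: "s \<in> carrier R \<Longrightarrow> lmul s \<in> carrier max_quot"
  by (simp add: max_quot_def pcl_lmul pmap_lmul)

lemma max_quot_mult:
  assumes "p \<in> carrier max_quot" "q \<in> carrier max_quot"
  shows "p \<otimes>\<^bsub>max_quot\<^esub> q \<in> carrier max_quot" "q O p \<subseteq> p \<otimes>\<^bsub>max_quot\<^esub> q" "pmap (q O p)"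
proof -
  show p: "pmap (q O p)" using assms by (auto intro: pmap_relcomp max_quotD)
  show "p \<otimes>\<^bsub>max_quot\<^esub> q \<in> carrier max_quot" "q O p \<subseteq> p \<otimes>\<^bsub>max_quot\<^esub> q"
    using pcl_in_max_quot[OF p] pcl_extensive[OF p] by (simp_all add: max_quot_def)
qed

lemma max_quot_add:
  assumes "p \<in> carrier max_quot" "q \<in> carrier max_quot"
  shows "p \<oplus>\<^bsub>max_quot\<^esub> q \<in> carrier max_quot" "padd p q \<subseteq> p \<oplus>\<^bsub>max_quot\<^esub> q" "pmap (padd p q)"
proof -
  show p: "pmap (padd p q)" using assms by (auto intro: pmap_padd max_quotD)
  show "p \<oplus>\<^bsub>max_quot\<^esub> q \<in> carrier max_quot" "padd p q \<subseteq> p \<oplus>\<^bsub>max_quot\<^esub> q"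
    using pcl_in_max_quot[OF p] pcl_extensive[OF p] by (simp_all add: max_quot_def)
qed

lemma padd_mono: "p \<subseteq> p' \<Longrightarrow> q \<subseteq> q' \<Longrightarrow> padd p q \<subseteq> padd p' q'"
  unfolding padd_def by blast

lemma max_quot_ring: "ring max_quot"
proof (rule ringI)
  let ?Q = "max_quot :: ('a \<times> 'a) set ring"
  show "abelian_group ?Q"
  proof (rule abelian_groupI)
    show "\<zero>\<^bsub>?Q\<^esub> \<in> carrier ?Q"
      using lmul_in_max_quot[of \<zero>] by (simp add: max_quot_def)
    show "p \<oplus>\<^bsub>?Q\<^esub> q \<in> carrier ?Q" if "p \<in> carrier ?Q" "q \<in> carrier ?Q" for p q
      using max_quot_add(1)[OF that] .
    show "p \<oplus>\<^bsub>?Q\<^esub> q = q \<oplus>\<^bsub>?Q\<^esub> p" if "p \<in> carrier ?Q" "q \<in> carrier ?Q" for p q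
    proof -
      have "padd p q = padd q p"
        unfolding padd_def using that[THEN max_quotD(1), THEN pmapD(2)] a_comm by blast
      thus ?thesis by (simp add: max_quot_def)
    qed
    show "\<zero>\<^bsub>?Q\<^esub> \<oplus>\<^bsub>?Q\<^esub> p = p" if p: "p \<in> carrier ?Q" for p
    proof -
      note P = pmapD[OF max_quotD(1)[OF p]]
      have "padd (lmul \<zero>) p = p"
        using P(1,2) by (force simp: padd_def lmul_def)
      thus ?thesis using max_quotD(2)[OF p] by (simp add: max_quot_def)
    qed
    show "\<exists>q\<in>carrier ?Q. q \<oplus>\<^bsub>?Q\<^esub> p = \<zero>\<^bsub>?Q\<^esub>" if p: "p \<in> carrier ?Q" for p
    proof
      \<comment> \<open>The negative is \<open>p\<close> followed by left multiplication with
        \<open>\<ominus> \<one>\<close>, which is right linear.\<close>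
      define n where "n = pcl (p O lmul (\<ominus> \<one>))"
      have n1: "pmap (p O lmul (\<ominus> \<one>))"
        by (intro pmap_relcomp pmap_lmul max_quotD(1)[OF p]) simp
      show n: "n \<in> carrier ?Q"
        unfolding n_def by (rule pcl_in_max_quot[OF n1])
      have g: "pmap (padd (p O lmul (\<ominus> \<one>)) p)"
        by (intro pmap_padd n1 max_quotD(1)[OF p])
      show "n \<oplus>\<^bsub>?Q\<^esub> p = \<zero>\<^bsub>?Q\<^esub>"
      proof (rule max_quot_eqI[OF max_quot_add(1)[OF n p] _ g])
        show "\<zero>\<^bsub>?Q\<^esub> \<in> carrier ?Q"
          using lmul_in_max_quot[of \<zero>] by (simp add: max_quot_def)
        show "padd (p O lmul (\<ominus> \<one>)) p \<subseteq> n \<oplus>\<^bsub>?Q\<^esub> p"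
          using max_quot_add(2)[OF n p] padd_mono[OF pcl_extensive[OF n1], of p p]
          by (auto simp: n_def)
        have "a = \<zero>" if xa: "(x, a) \<in> padd (p O lmul (\<ominus> \<one>)) p" for x a
        proof -
          obtain b z where bz: "(x, b) \<in> p O lmul (\<ominus> \<one>)" "(x, z) \<in> p" "a = b \<oplus> z"
            using xa unfolding padd_def by blast
          then obtain y where "(x, y) \<in> p" "y \<in> carrier R" "b = \<ominus> \<one> \<otimes> y"
            unfolding lmul_def by blast
          with bz have yz: "(x, y) \<in> p" "(x, z) \<in> p" "a = \<ominus> \<one> \<otimes> y \<oplus> z" "y \<in> carrier R"
            by simp_all
          moreover have "y = z" using pmap_fun[OF max_quotD(1)[OF p] yz(1,2)] .
          ultimately show ?thesis by (simp add: l_minus l_neg)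
        qed
        thus "padd (p O lmul (\<ominus> \<one>)) p \<subseteq> \<zero>\<^bsub>?Q\<^esub>"
          using pmapD(1)[OF g] by (fastforce simp: max_quot_def lmul_def)
      qed
    qed
    fix p q r assume pqr: "p \<in> carrier ?Q" "q \<in> carrier ?Q" "r \<in> carrier ?Q"
    note P = pmapD[OF max_quotD(1)[OF pqr(1)]] and Q = pmapD[OF max_quotD(1)[OF pqr(2)]]
      and R = pmapD[OF max_quotD(1)[OF pqr(3)]]
    have e: "padd (padd p q) r \<subseteq> padd p (padd q r)"
    proof
      fix z assume "z \<in> padd (padd p q) r"
      then obtain x a b c where z: "(x, a) \<in> p" "(x, b) \<in> q" "(x, c) \<in> r" "z = (x, a \<oplus> b \<oplus> c)"
        by (auto simp: padd_def)
      hence "z = (x, a \<oplus> (b \<oplus> c))"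
        using P(2)[OF z(1)] Q(2)[OF z(2)] R(2)[OF z(3)] by (simp add: a_assoc)
      thus "z \<in> padd p (padd q r)" using z unfolding padd_def by blast
    qed
    note 1 = max_quot_add[OF pqr(1,2)] and 2 = max_quot_add[OF pqr(2,3)]
    note 3 = max_quot_add[OF 1(1) pqr(3)] and 4 = max_quot_add[OF pqr(1) 2(1)]
    show "(p \<oplus>\<^bsub>?Q\<^esub> q) \<oplus>\<^bsub>?Q\<^esub> r = p \<oplus>\<^bsub>?Q\<^esub> (q \<oplus>\<^bsub>?Q\<^esub> r)"
    proof (rule max_quot_eqI[OF 3(1) 4(1)])
      show "pmap (padd (padd p q) r)" by (intro pmap_padd pqr[THEN max_quotD(1)])
    qed (use e 3(2) 4(2) padd_mono[OF 1(2) order_refl, of r] padd_mono[OF order_refl 2(2), of p]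
          in blast)+
  qed
  show "monoid ?Q"
  proof (rule monoidI)
    show "p \<otimes>\<^bsub>?Q\<^esub> q \<in> carrier ?Q" if "p \<in> carrier ?Q" "q \<in> carrier ?Q" for p q
      using max_quot_mult(1)[OF that] .
    show "\<one>\<^bsub>?Q\<^esub> \<in> carrier ?Q"
      using lmul_in_max_quot[of \<one>] by (simp add: max_quot_def)
    show "\<one>\<^bsub>?Q\<^esub> \<otimes>\<^bsub>?Q\<^esub> p = p" if p: "p \<in> carrier ?Q" for p
    proof -
      have "p O lmul \<one> = p"
        using pmapD(2)[OF max_quotD(1)[OF p]] by (force simp: lmul_def)
      thus ?thesis using max_quotD(2)[OF p] by (simp add: max_quot_def)
    qed
    show "p \<otimes>\<^bsub>?Q\<^esub> \<one>\<^bsub>?Q\<^esub> = p" if p: "p \<in> carrier ?Q" for p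
    proof -
      have "lmul \<one> O p = p"
        using pmapD(1)[OF max_quotD(1)[OF p]] by (force simp: lmul_def)
      thus ?thesis using max_quotD(2)[OF p] by (simp add: max_quot_def)
    qed
    fix p q r assume pqr: "p \<in> carrier ?Q" "q \<in> carrier ?Q" "r \<in> carrier ?Q"
    note 1 = max_quot_mult[OF pqr(1,2)] and 2 = max_quot_mult[OF pqr(2,3)]
    note 3 = max_quot_mult[OF 1(1) pqr(3)] and 4 = max_quot_mult[OF pqr(1) 2(1)]
    show "(p \<otimes>\<^bsub>?Q\<^esub> q) \<otimes>\<^bsub>?Q\<^esub> r = p \<otimes>\<^bsub>?Q\<^esub> (q \<otimes>\<^bsub>?Q\<^esub> r)"
    proof (rule max_quot_eqI[OF 3(1) 4(1)])
      show "pmap (r O (q O p))" by (intro pmap_relcomp pqr[THEN max_quotD(1)])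
    qed (use 1(2) 2(2) 3(2) 4(2) in blast)+
  qed
  fix p q r assume pqr: "p \<in> carrier ?Q" "q \<in> carrier ?Q" "r \<in> carrier ?Q"
  note 1 = max_quot_add[OF pqr(1,2)] and pr = max_quot_mult[OF pqr(1,3)]
    and qr = max_quot_mult[OF pqr(2,3)] and rp = max_quot_mult[OF pqr(3,1)]
    and rq = max_quot_mult[OF pqr(3,2)]
  note R = pmapD[OF max_quotD(1)[OF pqr(3)]]
  note 2 = max_quot_mult[OF 1(1) pqr(3)] and 3 = max_quot_add[OF pr(1) qr(1)]
  show "(p \<oplus>\<^bsub>?Q\<^esub> q) \<otimes>\<^bsub>?Q\<^esub> r = p \<otimes>\<^bsub>?Q\<^esub> r \<oplus>\<^bsub>?Q\<^esub> q \<otimes>\<^bsub>?Q\<^esub> r"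
  proof (rule max_quot_eqI[OF 2(1) 3(1), of "r O padd p q"])
    show "pmap (r O padd p q)" by (intro pmap_relcomp 1(3) max_quotD(1)[OF pqr(3)])
    show "r O padd p q \<subseteq> (p \<oplus>\<^bsub>?Q\<^esub> q) \<otimes>\<^bsub>?Q\<^esub> r" using 1(2) 2(2) by blast
    have "r O padd p q \<subseteq> padd (r O p) (r O q)" by (auto simp: padd_def)
    also have "\<dots> \<subseteq> p \<otimes>\<^bsub>?Q\<^esub> r \<oplus>\<^bsub>?Q\<^esub> q \<otimes>\<^bsub>?Q\<^esub> r"
      using padd_mono[OF pr(2) qr(2)] 3(2) by blast
    finally show "r O padd p q \<subseteq> p \<otimes>\<^bsub>?Q\<^esub> r \<oplus>\<^bsub>?Q\<^esub> q \<otimes>\<^bsub>?Q\<^esub> r" .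
  qed
  note 4 = max_quot_mult[OF pqr(3) 1(1)] and 5 = max_quot_add[OF rp(1) rq(1)]
  show "r \<otimes>\<^bsub>?Q\<^esub> (p \<oplus>\<^bsub>?Q\<^esub> q) = r \<otimes>\<^bsub>?Q\<^esub> p \<oplus>\<^bsub>?Q\<^esub> r \<otimes>\<^bsub>?Q\<^esub> q"
  proof (rule max_quot_eqI[OF 4(1) 5(1), of "padd (p O r) (q O r)"])
    show "pmap (padd (p O r) (q O r))" by (intro pmap_padd rp(3) rq(3))
    show "padd (p O r) (q O r) \<subseteq> r \<otimes>\<^bsub>?Q\<^esub> p \<oplus>\<^bsub>?Q\<^esub> r \<otimes>\<^bsub>?Q\<^esub> q"
      using padd_mono[OF rp(2) rq(2)] 5(2) by blast
    \<comment> \<open>Only an inclusion: a sum of two values may lie in the domain of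
      \<open>r\<close> although the values themselves do not.\<close>
    have "padd (p O r) (q O r) \<subseteq> padd p q O r"
      using R(4) unfolding padd_def by blast
    thus "padd (p O r) (q O r) \<subseteq> r \<otimes>\<^bsub>?Q\<^esub> (p \<oplus>\<^bsub>?Q\<^esub> q)"
      using 1(2) 4(2) by blast
  qed
qed

section \<open>The embedding of the base ring, extension of homomorphisms, and denominators\<close>

lemma lmul_hom: "lmul \<in> ring_hom R max_quot"
proof (rule ring_hom_memI)
  fix a b assume ab: "a \<in> carrier R" "b \<in> carrier R"
  show "lmul a \<in> carrier max_quot" using lmul_in_max_quot ab by blast
  have "lmul b O lmul a = lmul (a \<otimes> b)"
    using ab by (force simp: lmul_def m_assoc)
  thus "lmul (a \<otimes> b) = lmul a \<otimes>\<^bsub>max_quot\<^esub> lmul b"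
    using ab by (simp add: max_quot_def pcl_lmul)
  have "padd (lmul a) (lmul b) = lmul (a \<oplus> b)"
    using ab by (force simp: lmul_def padd_def l_distr)
  thus "lmul (a \<oplus> b) = lmul a \<oplus>\<^bsub>max_quot\<^esub> lmul b"
    using ab by (simp add: max_quot_def pcl_lmul)
qed (simp add: max_quot_def)

lemma lmul_inj: "inj_on lmul (carrier R)"
proof (rule inj_onI)
  fix a b assume ab: "a \<in> carrier R" "b \<in> carrier R" "lmul a = lmul b"
  have "(\<one>, a \<otimes> \<one>) \<in> lmul b" unfolding ab(3)[symmetric] by (auto simp: lmul_def)
  thus "a = b" using ab by (auto simp: lmul_def)
qed

text \<open>Multiplying by \<open>lmul x\<close> is evaluation at \<open>x\<close>, so
  \<open>(x, y) \<in> q\<close> reads as \<open>q x = y\<close> in the quotient ring. The equation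
  yields values of \<open>q\<close> only at those \<open>x r\<close> in its domain; closedness of
  \<open>q\<close> then gives the value at \<open>x\<close>.\<close>

lemma max_quot_apply:
  assumes q: "q \<in> carrier max_quot" and xy: "x \<in> carrier R" "y \<in> carrier R"
  shows "q \<otimes>\<^bsub>max_quot\<^esub> lmul x = lmul y \<longleftrightarrow> (x, y) \<in> q"
proof
  note Q = pmapD[OF max_quotD(1)[OF q]]
  note m = max_quot_mult[OF q lmul_in_max_quot[OF xy(1)]]
  {
    assume "(x, y) \<in> q"
    hence "lmul y \<subseteq> lmul x O q"
      using Q(5) xy by (force simp: lmul_def)
    thus "q \<otimes>\<^bsub>max_quot\<^esub> lmul x = lmul y"
      using max_quot_eqI[OF m(1) lmul_in_max_quot[OF xy(2)] pmap_lmul[OF xy(2)]] m(2) by blast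
  next
    assume e: "q \<otimes>\<^bsub>max_quot\<^esub> lmul x = lmul y"
    have "(x \<otimes> r, y \<otimes> r) \<in> q" if r: "r \<in> {r \<in> carrier R. x \<otimes> r \<in> Domain q}" for r
    proof -
      obtain w where w: "(x \<otimes> r, w) \<in> q" using r by blast
      hence "(r, w) \<in> lmul x O q" using r by (auto simp: lmul_def)
      hence "(r, w) \<in> lmul y" using m(2) e by blast
      thus ?thesis using w by (auto simp: lmul_def)
    qed
    hence "(x, y) \<in> pcl q"
      unfolding pcl_def
      using xy ess_preimage[OF pmap_Domain[OF max_quotD(1)[OF q]] xy(1)] by blast
    thus "(x, y) \<in> q" using max_quotD(2)[OF q] by simp
  }
qed

text \<open>\<open>f\<close> is extended by zero to a complement \<open>C\<close> of
  \<open>I\<close>. The sum \<open>I + C\<close> is direct, so this is well defined, and it is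
  essential, so the closure of the extension is an element of the quotient ring.\<close>

lemma max_quot_extend:
  assumes I: "right_ideal I R" and f: "f \<in> I \<rightarrow> carrier R"
    and fa: "\<And>x y. x \<in> I \<Longrightarrow> y \<in> I \<Longrightarrow> f (x \<oplus> y) = f x \<oplus> f y"
    and fm: "\<And>x r. x \<in> I \<Longrightarrow> r \<in> carrier R \<Longrightarrow> f (x \<otimes> r) = f x \<otimes> r"
  shows "\<exists>c\<in>carrier max_quot. \<forall>x\<in>I. c \<otimes>\<^bsub>max_quot\<^esub> lmul x = lmul (f x)"
proof -
  note I' = right_idealD[OF I]
  obtain C where C: "right_ideal C R" "I \<inter> C = {\<zero>}" "ess {x \<oplus> y |x y. x \<in> I \<and> y \<in> C}"
    using ex_complement[OF I] by blast
  note C' = right_idealD[OF C(1)]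
  have fc: "f x \<in> carrier R" if "x \<in> I" for x using f that by blast
  have f0: "f \<zero> = \<zero>" using fm[of \<zero> \<zero>] I'(2) fc by auto
  define g where "g = {(x \<oplus> y, f x) |x y. x \<in> I \<and> y \<in> C}"
  have g: "pmap g"
  proof (rule pmapI)
    show "x \<in> carrier R \<and> y \<in> carrier R" if "(x, y) \<in> g" for x y
      using that I'(1) C'(1) fc by (auto simp: g_def)
    have "(\<zero> \<oplus> \<zero>, f \<zero>) \<in> g" using I'(2) C'(2) unfolding g_def by blast
    thus "(\<zero>, \<zero>) \<in> g" using f0 by simp
    show "(x \<oplus> x', y \<oplus> y') \<in> g" if xy: "(x, y) \<in> g" "(x', y') \<in> g" for x y x' y'
    proof -
      obtain i c where ic: "x = i \<oplus> c" "y = f i" "i \<in> I" "c \<in> C" using xy(1) by (auto simp: g_def)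
      obtain i' c' where ic': "x' = i' \<oplus> c'" "y' = f i'" "i' \<in> I" "c' \<in> C"
        using xy(2) by (auto simp: g_def)
      have "i \<in> carrier R" "i' \<in> carrier R" "c \<in> carrier R" "c' \<in> carrier R"
        using ic ic' I'(1) C'(1) by auto
      hence "x \<oplus> x' = (i \<oplus> i') \<oplus> (c \<oplus> c')" using ic ic' by (simp add: a_ac)
      moreover have "y \<oplus> y' = f (i \<oplus> i')" using fa ic ic' by simp
      ultimately show ?thesis using I'(3)[OF ic(3) ic'(3)] C'(3)[OF ic(4) ic'(4)]
        unfolding g_def by blast
    qed
    show "(x \<otimes> s, y \<otimes> s) \<in> g" if xy: "(x, y) \<in> g" "s \<in> carrier R" for x y s
    proof -
      obtain i c where ic: "x = i \<oplus> c" "y = f i" "i \<in> I" "c \<in> C" using xy(1) by (auto simp: g_def)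
      hence "x \<otimes> s = i \<otimes> s \<oplus> c \<otimes> s" using I'(1) C'(1) xy(2) by (auto intro: l_distr)
      moreover have "y \<otimes> s = f (i \<otimes> s)" using fm ic xy(2) by simp
      ultimately show ?thesis using I'(4)[OF ic(3) xy(2)] C'(4)[OF ic(4) xy(2)]
        unfolding g_def by blast
    qed
    show "y = \<zero>" if xy: "(\<zero>, y) \<in> g" for y
    proof -
      obtain i c where ic: "\<zero> = i \<oplus> c" "y = f i" "i \<in> I" "c \<in> C" using xy by (auto simp: g_def)
      hence "i = \<ominus> c" using I'(1) C'(1) by (metis minus_equality subsetD)
      hence "i \<in> I \<inter> C" using ic C'(5) by blast
      thus ?thesis using C(2) ic(2) f0 by simp
    qed
    have "Domain g = {x \<oplus> y |x y. x \<in> I \<and> y \<in> C}" by (auto simp: g_def)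
    thus "\<exists>s\<in>carrier R. x \<otimes> s \<in> Domain g \<and> x \<otimes> s \<noteq> \<zero>" if "x \<in> carrier R" "x \<noteq> \<zero>" for x
      using C(3) that by (auto simp: ess_def)
  qed
  have "pcl g \<otimes>\<^bsub>max_quot\<^esub> lmul x = lmul (f x)" if x: "x \<in> I" for x
  proof -
    have "x = x \<oplus> \<zero>" using x I'(1) by auto
    hence "(x, f x) \<in> g" unfolding g_def using x C'(2) by blast
    hence "(x, f x) \<in> pcl g" using pcl_extensive[OF g] by blast
    thus ?thesis
      using max_quot_apply[OF pcl_in_max_quot[OF g], of x "f x"] I'(1) fc x by blast
  qed
  thus ?thesis using pcl_in_max_quot[OF g] by blast
qed

lemma max_quot_ess:
  assumes q: "q \<in> carrier max_quot"
  shows "ess {s \<in> carrier R. q \<otimes>\<^bsub>max_quot\<^esub> lmul s \<in> lmul ` carrier R}"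
proof -
  have "{s \<in> carrier R. q \<otimes>\<^bsub>max_quot\<^esub> lmul s \<in> lmul ` carrier R} = Domain q"
    using max_quot_apply[OF q] pmapD(1,2)[OF max_quotD(1)[OF q]] by blast
  thus ?thesis using pmap_Domain[OF max_quotD(1)[OF q]] by simp
qed

text \<open>\<open>q\<close> and the zero element share the zero map on \<open>E\<close> as a
  restriction.\<close>

lemma max_quot_nonsingular:
  assumes q: "q \<in> carrier max_quot" and E: "ess E"
    and z: "\<And>e. e \<in> E \<Longrightarrow> q \<otimes>\<^bsub>max_quot\<^esub> lmul e = \<zero>\<^bsub>max_quot\<^esub>"
  shows "q = \<zero>\<^bsub>max_quot\<^esub>"
proof -
  note E' = right_idealD[OF ess_right_ideal[OF E]]
  have z0: "\<zero>\<^bsub>max_quot\<^esub> = lmul \<zero>" by (simp add: max_quot_def)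
  have 0: "(e, \<zero>) \<in> q" if "e \<in> E" for e
    using max_quot_apply[OF q, of e \<zero>] z[OF that] that E'(1) z0 by auto
  have g: "pmap {(e, \<zero>) |e. e \<in> E}"
    by (rule pmapI) (use E' E in \<open>auto simp: ess_def Domain_unfold\<close>)
  show ?thesis
    by (rule max_quot_eqI[OF q _ g])
      (use 0 lmul_in_max_quot[of \<zero>] E'(1) in \<open>auto simp: z0 lmul_def\<close>)
qed

end

section \<open>Self-injectivity and regularity of the quotient ring\<close>

text \<open>Essentiality tested at \<open>t\<close> gives a nonzero \<open>t s\<close> in
  \<open>E\<close>; then \<open>s\<close> is nonzero, and a nonzero \<open>x\<close> cannot
  annihilate \<open>t s\<close>.\<close>

lemma (in ring) nonsingular_ringI:
  assumes t: "t \<in> carrier R"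
    and prime: "\<And>x y. x \<in> carrier R \<Longrightarrow> y \<in> carrier R \<Longrightarrow> x \<noteq> \<zero> \<Longrightarrow> y \<noteq> \<zero> \<Longrightarrow> x \<otimes> (t \<otimes> y) \<noteq> \<zero>"
  shows "nonsingular_ring R"
proof unfold_locales
  fix E x assume E: "ess E" and x: "x \<in> carrier R" and 0: "\<And>e. e \<in> E \<Longrightarrow> x \<otimes> e = \<zero>"
  show "x = \<zero>"
  proof (rule ccontr)
    assume nz: "x \<noteq> \<zero>"
    have "t \<noteq> \<zero>" using prime[OF x x nz nz] x by auto
    then obtain s where s: "s \<in> carrier R" "t \<otimes> s \<in> E" "t \<otimes> s \<noteq> \<zero>"
      using essE[OF E t] by blast
    hence "s \<noteq> \<zero>" using t by auto
    thus False using prime[OF x s(1) nz] 0[OF s(2)] by blast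
  qed
qed

text \<open>The interface through which the quotient ring is used: extension of homomorphisms from
  right ideals of \<open>S\<close> to \<open>S\<close>, essential sets of denominators, and no
  nonzero element killed by an essential right ideal. Nothing depends on graphs any more, so
  \<open>T\<close> may be a copy on another type.\<close>

locale right_quotient = S: ring S + ring T for S (structure) and T (structure) +
  fixes i
  assumes i_hom: "i \<in> ring_hom S T" and i_inj: "inj_on i (carrier S)"
    and extend: "\<And>I f. right_ideal I S \<Longrightarrow> f \<in> I \<rightarrow> carrier S \<Longrightarrow>
      (\<And>x y. x \<in> I \<Longrightarrow> y \<in> I \<Longrightarrow> f (x \<oplus>\<^bsub>S\<^esub> y) = f x \<oplus>\<^bsub>S\<^esub> f y) \<Longrightarrow>
      (\<And>x r. x \<in> I \<Longrightarrow> r \<in> carrier S \<Longrightarrow> f (x \<otimes>\<^bsub>S\<^esub> r) = f x \<otimes>\<^bsub>S\<^esub> r) \<Longrightarrow>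
      \<exists>c\<in>carrier T. \<forall>x\<in>I. c \<otimes>\<^bsub>T\<^esub> i x = i (f x)"
    and denominators: "\<And>q. q \<in> carrier T \<Longrightarrow> S.ess {s \<in> carrier S. q \<otimes>\<^bsub>T\<^esub> i s \<in> i ` carrier S}"
    and annihilator: "\<And>q E. q \<in> carrier T \<Longrightarrow> S.ess E \<Longrightarrow> (\<And>e. e \<in> E \<Longrightarrow> q \<otimes>\<^bsub>T\<^esub> i e = \<zero>\<^bsub>T\<^esub>)
      \<Longrightarrow> q = \<zero>\<^bsub>T\<^esub>"

text \<open>Transport of structure along \<open>\<phi>\<close>: the construction produces sets of
  pairs, while the final ring is required on a prescribed type.\<close>

lemma (in nonsingular_ring) right_quotient_exists:
  assumes \<phi>: "inj_on \<phi> (carrier max_quot)"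
  shows "right_quotient R (image_ring \<phi> max_quot) (\<phi> \<circ> lmul)"
proof -
  let ?Q = "max_quot :: ('a \<times> 'a) set ring" and ?T = "image_ring \<phi> max_quot"
  interpret Q: ring ?Q by (rule max_quot_ring)
  have iso: "\<phi> \<in> ring_iso ?Q ?T" by (rule inj_imp_image_ring_iso[OF \<phi>])
  hence h: "\<phi> \<in> ring_hom ?Q ?T" by (simp add: ring_iso_def)
  have ca: "carrier ?T = \<phi> ` carrier ?Q" by (rule image_ring_carrier)
  have mult: "\<phi> (p \<otimes>\<^bsub>?Q\<^esub> q) = \<phi> p \<otimes>\<^bsub>?T\<^esub> \<phi> q" if "p \<in> carrier ?Q" "q \<in> carrier ?Q" for p q
    using ring_hom_mult[OF h that] .
  interpret T: ring ?T by (rule Q.inj_imp_image_ring_is_ring[OF \<phi>])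
  show ?thesis
  proof unfold_locales
    show "\<phi> \<circ> lmul \<in> ring_hom R ?T" by (rule ring_hom_trans[OF lmul_hom h])
    show "inj_on (\<phi> \<circ> lmul) (carrier R)"
      by (rule comp_inj_on[OF lmul_inj inj_on_subset[OF \<phi>]]) (use lmul_in_max_quot in blast)
  next
    fix I f assume "right_ideal I R" "f \<in> I \<rightarrow> carrier R"
      "\<And>x y. x \<in> I \<Longrightarrow> y \<in> I \<Longrightarrow> f (x \<oplus> y) = f x \<oplus> f y"
      "\<And>x r. x \<in> I \<Longrightarrow> r \<in> carrier R \<Longrightarrow> f (x \<otimes> r) = f x \<otimes> r"
    note f = this
    obtain c where c: "c \<in> carrier ?Q" "\<forall>x\<in>I. c \<otimes>\<^bsub>?Q\<^esub> lmul x = lmul (f x)"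
      using max_quot_extend[OF f] by blast
    have "\<phi> c \<otimes>\<^bsub>?T\<^esub> (\<phi> \<circ> lmul) x = (\<phi> \<circ> lmul) (f x)" if x: "x \<in> I" for x
    proof -
      have "x \<in> carrier R" using right_idealD(1)[OF f(1)] x by blast
      thus ?thesis using mult[OF c(1) lmul_in_max_quot, of x] c(2) x by auto
    qed
    thus "\<exists>c\<in>carrier ?T. \<forall>x\<in>I. c \<otimes>\<^bsub>?T\<^esub> (\<phi> \<circ> lmul) x = (\<phi> \<circ> lmul) (f x)"
      unfolding ca using c(1) by blast
  next
    fix q' assume "q' \<in> carrier ?T"
    then obtain q where q: "q' = \<phi> q" "q \<in> carrier ?Q" unfolding ca by blast
    have "q' \<otimes>\<^bsub>?T\<^esub> (\<phi> \<circ> lmul) s \<in> (\<phi> \<circ> lmul) ` carrier R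
        \<longleftrightarrow> q \<otimes>\<^bsub>?Q\<^esub> lmul s \<in> lmul ` carrier R" if s: "s \<in> carrier R" for s
    proof -
      have e: "q' \<otimes>\<^bsub>?T\<^esub> (\<phi> \<circ> lmul) s = \<phi> (q \<otimes>\<^bsub>?Q\<^esub> lmul s)"
        using mult[OF q(2) lmul_in_max_quot[OF s]] q by simp
      have m: "q \<otimes>\<^bsub>?Q\<^esub> lmul s \<in> carrier ?Q"
        using q(2) lmul_in_max_quot[OF s] by simp
      have "\<phi> (q \<otimes>\<^bsub>?Q\<^esub> lmul s) \<in> \<phi> ` (lmul ` carrier R) \<longleftrightarrow> q \<otimes>\<^bsub>?Q\<^esub> lmul s \<in> lmul ` carrier R"
        by (rule inj_on_image_mem_iff[OF \<phi> m]) (use lmul_in_max_quot in blast)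
      thus ?thesis unfolding e by (simp add: image_comp)
    qed
    hence "{s \<in> carrier R. q' \<otimes>\<^bsub>?T\<^esub> (\<phi> \<circ> lmul) s \<in> (\<phi> \<circ> lmul) ` carrier R}
      = {s \<in> carrier R. q \<otimes>\<^bsub>?Q\<^esub> lmul s \<in> lmul ` carrier R}" by blast
    thus "ess {s \<in> carrier R. q' \<otimes>\<^bsub>?T\<^esub> (\<phi> \<circ> lmul) s \<in> (\<phi> \<circ> lmul) ` carrier R}"
      using max_quot_ess[OF q(2)] by simp
  next
    fix q' E assume q': "q' \<in> carrier ?T" and E: "ess E"
      and z: "\<And>e. e \<in> E \<Longrightarrow> q' \<otimes>\<^bsub>?T\<^esub> (\<phi> \<circ> lmul) e = \<zero>\<^bsub>?T\<^esub>"
    obtain q where q: "q' = \<phi> q" "q \<in> carrier ?Q" using q' unfolding ca by blast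
    have "q \<otimes>\<^bsub>?Q\<^esub> lmul e = \<zero>\<^bsub>?Q\<^esub>" if e: "e \<in> E" for e
    proof -
      have ec: "lmul e \<in> carrier ?Q" using lmul_in_max_quot ess_subset[OF E] e by blast
      have "\<phi> (q \<otimes>\<^bsub>?Q\<^esub> lmul e) = \<phi> \<zero>\<^bsub>?Q\<^esub>"
        using z[OF e] mult[OF q(2) ec] q(1) by (simp add: image_ring_zero)
      thus ?thesis using inj_onD[OF \<phi>] q(2) ec by blast
    qed
    hence "q = \<zero>\<^bsub>?Q\<^esub>" by (rule max_quot_nonsingular[OF q(2) E])
    thus "q' = \<zero>\<^bsub>?T\<^esub>" by (simp add: q(1) image_ring_zero)
  qed
qed

section \<open>Injectivity, regularity and one-sided inverses from the quotient interface\<close>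

context right_quotient
begin

lemma i_simps:
  "x \<in> carrier S \<Longrightarrow> i x \<in> carrier T"
  "x \<in> carrier S \<Longrightarrow> y \<in> carrier S \<Longrightarrow> i (x \<otimes>\<^bsub>S\<^esub> y) = i x \<otimes>\<^bsub>T\<^esub> i y"
  "x \<in> carrier S \<Longrightarrow> y \<in> carrier S \<Longrightarrow> i (x \<oplus>\<^bsub>S\<^esub> y) = i x \<oplus>\<^bsub>T\<^esub> i y"
  "i \<one>\<^bsub>S\<^esub> = \<one>\<^bsub>T\<^esub>"
  using i_hom by (auto simp: ring_hom_def)

lemma i_zero: "i \<zero>\<^bsub>S\<^esub> = \<zero>\<^bsub>T\<^esub>"
  by (rule ring_hom_zero[OF i_hom S.ring_axioms ring_axioms])

lemma i_eq_iff: "x \<in> carrier S \<Longrightarrow> y \<in> carrier S \<Longrightarrow> i x = i y \<longleftrightarrow> x = y"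
  using i_inj by (auto simp: inj_on_def)

lemma eq_on_ess:
  assumes "p \<in> carrier T" "q \<in> carrier T" "S.ess E" "\<And>e. e \<in> E \<Longrightarrow> p \<otimes>\<^bsub>T\<^esub> i e = q \<otimes>\<^bsub>T\<^esub> i e"
  shows "p = q"
proof -
  have "p \<ominus>\<^bsub>T\<^esub> q = \<zero>\<^bsub>T\<^esub>"
  proof (rule annihilator[OF _ assms(3)])
    fix e assume e: "e \<in> E"
    have "i e \<in> carrier T" using S.ess_subset[OF assms(3)] e i_simps(1) by blast
    thus "(p \<ominus>\<^bsub>T\<^esub> q) \<otimes>\<^bsub>T\<^esub> i e = \<zero>\<^bsub>T\<^esub>"
      using assms(1,2) assms(4)[OF e] by (simp add: minus_eq l_distr l_minus r_neg)
  qed (use assms in simp)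
  thus ?thesis using assms by simp
qed

text \<open>Extension is available only for maps from right ideals of \<open>S\<close> into
  \<open>S\<close>. So \<open>f\<close> is restricted to the elements of \<open>S\<close> whose
  image lies in \<open>I\<close> and has its value in the image of \<open>S\<close>. The resulting
  \<open>c\<close> agrees with \<open>f\<close> at each \<open>a\<close> in \<open>I\<close>,
  because \<open>a\<close> and \<open>f a\<close> share an essential right ideal of
  denominators.\<close>

lemma right_self_injective: "right_self_injective T"
  unfolding right_self_injective_def
proof (intro allI impI, elim conjE)
  fix I f assume I: "right_ideal I T" and f: "f ` I \<subseteq> carrier T"
    and fa: "\<forall>a\<in>I. \<forall>b\<in>I. f (a \<oplus>\<^bsub>T\<^esub> b) = f a \<oplus>\<^bsub>T\<^esub> f b"
    and fm: "\<forall>a\<in>I. \<forall>x\<in>carrier T. f (a \<otimes>\<^bsub>T\<^esub> x) = f a \<otimes>\<^bsub>T\<^esub> x"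
  note I' = right_idealD[OF I]
  define D where "D = {s \<in> carrier S. i s \<in> I \<and> f (i s) \<in> i ` carrier S}"
  define g where "g s = inv_into (carrier S) i (f (i s))" for s
  have Dc: "s \<in> carrier S" "i s \<in> I" "g s \<in> carrier S" "i (g s) = f (i s)" if s: "s \<in> D" for s
    using s unfolding D_def g_def by (auto simp: f_inv_into_f inv_into_into)
  have DI: "s \<in> D" "g s = s'" if "s \<in> carrier S" "i s \<in> I" "s' \<in> carrier S" "f (i s) = i s'" for s s'
    using that unfolding D_def g_def by (auto simp: inv_into_f_f[OF i_inj])
  have Da: "x \<oplus>\<^bsub>S\<^esub> y \<in> D" "g (x \<oplus>\<^bsub>S\<^esub> y) = g x \<oplus>\<^bsub>S\<^esub> g y" if xy: "x \<in> D" "y \<in> D" for x y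
  proof -
    have "f (i (x \<oplus>\<^bsub>S\<^esub> y)) = i (g x \<oplus>\<^bsub>S\<^esub> g y)"
      using xy[THEN Dc(1)] xy[THEN Dc(2)] xy[THEN Dc(3)] xy[THEN Dc(4)] fa by (simp add: i_simps)
    moreover have "i (x \<oplus>\<^bsub>S\<^esub> y) \<in> I"
      using xy[THEN Dc(1)] xy[THEN Dc(2)] I'(3) by (simp add: i_simps)
    ultimately show "x \<oplus>\<^bsub>S\<^esub> y \<in> D" "g (x \<oplus>\<^bsub>S\<^esub> y) = g x \<oplus>\<^bsub>S\<^esub> g y"
      using DI[of "x \<oplus>\<^bsub>S\<^esub> y" "g x \<oplus>\<^bsub>S\<^esub> g y"] xy[THEN Dc(1)] xy[THEN Dc(3)] by simp_all
  qed
  have Dm: "x \<otimes>\<^bsub>S\<^esub> r \<in> D" "g (x \<otimes>\<^bsub>S\<^esub> r) = g x \<otimes>\<^bsub>S\<^esub> r" if xr: "x \<in> D" "r \<in> carrier S" for x r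
  proof -
    have "f (i (x \<otimes>\<^bsub>S\<^esub> r)) = i (g x \<otimes>\<^bsub>S\<^esub> r)"
      using Dc[OF xr(1)] xr(2) fm by (simp add: i_simps)
    moreover have "i (x \<otimes>\<^bsub>S\<^esub> r) \<in> I"
      using Dc[OF xr(1)] xr(2) I'(4) by (simp add: i_simps)
    ultimately show "x \<otimes>\<^bsub>S\<^esub> r \<in> D" "g (x \<otimes>\<^bsub>S\<^esub> r) = g x \<otimes>\<^bsub>S\<^esub> r"
      using DI[of "x \<otimes>\<^bsub>S\<^esub> r" "g x \<otimes>\<^bsub>S\<^esub> r"] Dc[OF xr(1)] xr(2) by simp_all
  qed
  have f0: "f \<zero>\<^bsub>T\<^esub> = \<zero>\<^bsub>T\<^esub>"
    using fm I'(2) f by (metis r_null zero_closed image_subset_iff)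
  have "right_ideal D S"
  proof (rule S.right_idealI)
    show "D \<subseteq> carrier S" using Dc(1) by blast
    show "\<zero>\<^bsub>S\<^esub> \<in> D" using DI(1)[of "\<zero>\<^bsub>S\<^esub>" "\<zero>\<^bsub>S\<^esub>"] I'(2) f0 by (simp add: i_zero)
  qed (auto simp: Da(1) Dm(1))
  then obtain c where c: "c \<in> carrier T" "\<forall>x\<in>D. c \<otimes>\<^bsub>T\<^esub> i x = i (g x)"
    using extend[of D g] Dc(3) Da(2) Dm(2) by blast
  have "f a = c \<otimes>\<^bsub>T\<^esub> a" if a: "a \<in> I" for a
  proof -
    have ac: "a \<in> carrier T" "f a \<in> carrier T" using a I'(1) f by auto
    have "c \<otimes>\<^bsub>T\<^esub> a = f a"
    proof (rule eq_on_ess[OF _ ac(2) S.ess_Int[OF denominators[OF ac(1)] denominators[OF ac(2)]]])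
      fix e assume e: "e \<in> {s \<in> carrier S. a \<otimes>\<^bsub>T\<^esub> i s \<in> i ` carrier S}
        \<inter> {s \<in> carrier S. f a \<otimes>\<^bsub>T\<^esub> i s \<in> i ` carrier S}"
      then obtain s s' where s: "e \<in> carrier S" "s \<in> carrier S" "s' \<in> carrier S"
        "a \<otimes>\<^bsub>T\<^esub> i e = i s" "f a \<otimes>\<^bsub>T\<^esub> i e = i s'" by blast
      have "i s \<in> I" using I'(4)[OF a i_simps(1)[OF s(1)]] s(4) by simp
      moreover have fs: "f (i s) = i s'"
        using fm a i_simps(1)[OF s(1)] s(4,5) by metis
      ultimately have "s \<in> D" "g s = s'" using DI s by blast+
      hence "c \<otimes>\<^bsub>T\<^esub> i s = i s'" using c(2) by blast
      thus "c \<otimes>\<^bsub>T\<^esub> a \<otimes>\<^bsub>T\<^esub> i e = f a \<otimes>\<^bsub>T\<^esub> i e"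
        using s c(1) ac(1) by (simp add: m_assoc i_simps)
    qed (use c ac in simp)
    thus ?thesis by simp
  qed
  thus "\<exists>c\<in>carrier T. \<forall>a\<in>I. f a = c \<otimes>\<^bsub>T\<^esub> a" using c(1) by blast
qed

text \<open>Left multiplication by \<open>q\<close> is injective on a complement of its kernel, and a partial inverse
  extends to an element of \<open>T\<close>.\<close>
lemma von_neumann_regular: "von_neumann_regular T"
  unfolding von_neumann_regular_def
proof
  fix q assume q: "q \<in> carrier T"
  define D where "D = {s \<in> carrier S. q \<otimes>\<^bsub>T\<^esub> i s \<in> i ` carrier S}"
  have D: "S.ess D" unfolding D_def by (rule denominators[OF q])
  note D' = S.right_idealD[OF S.ess_right_ideal[OF D]]
  define K where "K = {s \<in> carrier S. q \<otimes>\<^bsub>T\<^esub> i s = \<zero>\<^bsub>T\<^esub>}"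
  have K: "right_ideal K S"
  proof (rule S.right_idealI)
    show "x \<oplus>\<^bsub>S\<^esub> y \<in> K" if "x \<in> K" "y \<in> K" for x y
      using that q by (simp add: K_def i_simps r_distr)
    show "x \<otimes>\<^bsub>S\<^esub> r \<in> K" if xr: "x \<in> K" "r \<in> carrier S" for x r
    proof -
      have x: "x \<in> carrier S" "q \<otimes>\<^bsub>T\<^esub> i x = \<zero>\<^bsub>T\<^esub>" using xr(1) by (auto simp: K_def)
      have "q \<otimes>\<^bsub>T\<^esub> i (x \<otimes>\<^bsub>S\<^esub> r) = (q \<otimes>\<^bsub>T\<^esub> i x) \<otimes>\<^bsub>T\<^esub> i r"
        using q x(1) xr(2) by (simp add: i_simps m_assoc)
      thus ?thesis using x xr(2) i_simps(1) by (simp add: K_def)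
    qed
  qed (use q in \<open>auto simp: K_def i_zero\<close>)
  note K' = S.right_idealD[OF K]
  have KD: "K \<subseteq> D"
  proof
    fix s assume "s \<in> K"
    moreover have "\<zero>\<^bsub>T\<^esub> \<in> i ` carrier S" using i_zero S.zero_closed by (metis imageI)
    ultimately show "s \<in> D" by (simp add: K_def D_def)
  qed
  obtain C where C: "right_ideal C S" "K \<inter> C = {\<zero>\<^bsub>S\<^esub>}" "S.ess {x \<oplus>\<^bsub>S\<^esub> y |x y. x \<in> K \<and> y \<in> C}"
    using S.ex_complement[OF K] by blast
  \<comment> \<open>Inside \<open>D\<close> multiplication by \<open>q\<close> lands in
    \<open>S\<close>; inside \<open>C\<close>, which meets the kernel \<open>K\<close> trivially, it
    is injective.\<close>
  define G where "G = C \<inter> D"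
  have G: "right_ideal G S"
    unfolding G_def by (rule S.right_ideal_Int[OF C(1) S.ess_right_ideal[OF D]])
  note G' = S.right_idealD[OF G]
  define q' where "q' s = inv_into (carrier S) i (q \<otimes>\<^bsub>T\<^esub> i s)" for s
  have q': "q' s \<in> carrier S" "i (q' s) = q \<otimes>\<^bsub>T\<^esub> i s" if s: "s \<in> G" for s
    using s unfolding G_def D_def q'_def by (auto simp: f_inv_into_f inv_into_into)
  have q'a: "q' (x \<oplus>\<^bsub>S\<^esub> y) = q' x \<oplus>\<^bsub>S\<^esub> q' y" if xy: "x \<in> G" "y \<in> G" for x y
  proof -
    have c: "x \<in> carrier S" "y \<in> carrier S" using xy G'(1) by auto
    have "i (q' (x \<oplus>\<^bsub>S\<^esub> y)) = i (q' x \<oplus>\<^bsub>S\<^esub> q' y)"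
      using q'[OF G'(3)[OF xy]] q'[OF xy(1)] q'[OF xy(2)] c q
      by (simp add: i_simps r_distr)
    thus ?thesis
      using i_eq_iff q'[OF G'(3)[OF xy]] q'[OF xy(1)] q'[OF xy(2)] by simp
  qed
  have q'm: "q' (x \<otimes>\<^bsub>S\<^esub> r) = q' x \<otimes>\<^bsub>S\<^esub> r" if xr: "x \<in> G" "r \<in> carrier S" for x r
  proof -
    have c: "x \<in> carrier S" using xr G'(1) by auto
    have "i (q' (x \<otimes>\<^bsub>S\<^esub> r)) = i (q' x \<otimes>\<^bsub>S\<^esub> r)"
      using q'[OF G'(4)[OF xr]] q'[OF xr(1)] c q xr(2)
      by (simp add: i_simps m_assoc)
    thus ?thesis
      using i_eq_iff q'[OF G'(4)[OF xr]] q'[OF xr(1)] xr(2) by simp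
  qed
  have q'inj: "inj_on q' G"
  proof (rule inj_onI)
    fix x y assume xy: "x \<in> G" "y \<in> G" "q' x = q' y"
    have c: "x \<in> carrier S" "y \<in> carrier S" using xy G'(1) by auto
    have m: "x \<ominus>\<^bsub>S\<^esub> y \<in> G" by (rule G'(6)[OF xy(1,2)])
    have "i (x \<ominus>\<^bsub>S\<^esub> y) \<oplus>\<^bsub>T\<^esub> i y = i x"
      using c by (simp add: i_simps(3)[symmetric] S.minus_eq S.a_assoc S.l_neg)
    hence "q \<otimes>\<^bsub>T\<^esub> i (x \<ominus>\<^bsub>S\<^esub> y) \<oplus>\<^bsub>T\<^esub> q \<otimes>\<^bsub>T\<^esub> i y = q \<otimes>\<^bsub>T\<^esub> i x"
      using q c by (metis S.minus_closed i_simps(1) r_distr)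
    also have "q \<otimes>\<^bsub>T\<^esub> i x = q \<otimes>\<^bsub>T\<^esub> i y" using q'(2)[OF xy(1)] q'(2)[OF xy(2)] xy(3) by simp
    finally have "q \<otimes>\<^bsub>T\<^esub> i (x \<ominus>\<^bsub>S\<^esub> y) = \<zero>\<^bsub>T\<^esub>"
      using q c i_simps(1) by (metis S.minus_closed add.r_cancel_one m_closed)
    hence "x \<ominus>\<^bsub>S\<^esub> y \<in> K \<inter> C"
      using m c unfolding K_def G_def by auto
    hence "x \<ominus>\<^bsub>S\<^esub> y = \<zero>\<^bsub>S\<^esub>" using C(2) by blast
    thus "x = y" using c by simp
  qed
  define f where "f = inv_into G q'"
  have f: "f (q' s) = s" if "s \<in> G" for s
    unfolding f_def by (rule inv_into_f_f[OF q'inj that])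
  have I: "right_ideal (q' ` G) S"
  proof (rule S.right_idealI)
    show "q' ` G \<subseteq> carrier S" using q'(1) by blast
    have "q' (\<zero>\<^bsub>S\<^esub>) = \<zero>\<^bsub>S\<^esub>"
      using q'm[OF G'(2) S.zero_closed] q'(1)[OF G'(2)] by simp
    thus "\<zero>\<^bsub>S\<^esub> \<in> q' ` G" using G'(2) by (metis imageI)
    show "x \<oplus>\<^bsub>S\<^esub> y \<in> q' ` G" if xy: "x \<in> q' ` G" "y \<in> q' ` G" for x y
      using xy G'(3) by (auto simp flip: q'a)
    show "x \<otimes>\<^bsub>S\<^esub> r \<in> q' ` G" if xy: "x \<in> q' ` G" "r \<in> carrier S" for x r
      using xy G'(4) by (auto simp flip: q'm)
  qed
  have "\<exists>y\<in>carrier T. \<forall>x\<in>q' ` G. y \<otimes>\<^bsub>T\<^esub> i x = i (f x)"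
  proof (rule extend[OF I])
    show "f \<in> q' ` G \<rightarrow> carrier S" using f G'(1) by auto
    show "f (x \<oplus>\<^bsub>S\<^esub> y) = f x \<oplus>\<^bsub>S\<^esub> f y" if xy: "x \<in> q' ` G" "y \<in> q' ` G" for x y
      using xy f G'(3) by (auto simp flip: q'a)
    show "f (x \<otimes>\<^bsub>S\<^esub> r) = f x \<otimes>\<^bsub>S\<^esub> r" if xy: "x \<in> q' ` G" "r \<in> carrier S" for x r
      using xy f G'(4) by (auto simp flip: q'm)
  qed
  then obtain y where y: "y \<in> carrier T" "\<And>s. s \<in> G \<Longrightarrow> y \<otimes>\<^bsub>T\<^esub> (q \<otimes>\<^bsub>T\<^esub> i s) = i s"
    using f q'(2) by fastforce
  have "q = q \<otimes>\<^bsub>T\<^esub> y \<otimes>\<^bsub>T\<^esub> q"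
  \<comment> \<open>For \<open>e = k + c\<close> the element \<open>q\<close> kills
    \<open>k\<close>. Since \<open>K \<subseteq> D\<close>, the part \<open>c = e - k\<close> stays
    in \<open>D\<close>, hence in \<open>G\<close>, where \<open>y\<close> undoes
    \<open>q\<close>.\<close>
  proof (rule eq_on_ess[OF q _ S.ess_Int[OF C(3) D]])
    fix e assume e: "e \<in> {x \<oplus>\<^bsub>S\<^esub> y |x y. x \<in> K \<and> y \<in> C} \<inter> D"
    then obtain k c where kc: "e = k \<oplus>\<^bsub>S\<^esub> c" "k \<in> K" "c \<in> C" by blast
    have car: "k \<in> carrier S" "c \<in> carrier S"
      using kc K'(1) S.right_idealD(1)[OF C(1)] by auto
    have "c = e \<ominus>\<^bsub>S\<^esub> k" unfolding kc(1) using car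
      by (simp add: S.minus_eq S.a_assoc S.a_comm[of c] S.r_neg) (simp add: S.a_assoc[symmetric] S.r_neg)
    hence "c \<in> G" using D'(6)[of e k] e kc KD unfolding G_def by auto
    have qe: "q \<otimes>\<^bsub>T\<^esub> i e = q \<otimes>\<^bsub>T\<^esub> i c"
      using kc car q by (simp add: i_simps r_distr K_def)
    have "q \<otimes>\<^bsub>T\<^esub> y \<otimes>\<^bsub>T\<^esub> q \<otimes>\<^bsub>T\<^esub> i e = q \<otimes>\<^bsub>T\<^esub> (y \<otimes>\<^bsub>T\<^esub> (q \<otimes>\<^bsub>T\<^esub> i e))"
      using q y(1) kc car by (simp add: m_assoc i_simps)
    also have "\<dots> = q \<otimes>\<^bsub>T\<^esub> i e" unfolding qe y(2)[OF \<open>c \<in> G\<close>] ..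
    finally show "q \<otimes>\<^bsub>T\<^esub> i e = q \<otimes>\<^bsub>T\<^esub> y \<otimes>\<^bsub>T\<^esub> q \<otimes>\<^bsub>T\<^esub> i e" by simp
  qed (use q y in simp)
  thus "\<exists>y\<in>carrier T. q = q \<otimes>\<^bsub>T\<^esub> y \<otimes>\<^bsub>T\<^esub> q" using y(1) by blast
qed

text \<open>By injectivity the map sending \<open>x r\<close> to \<open>r\<close> is well defined
  and right linear on \<open>x S\<close>; the element of \<open>T\<close> extending it sends
  \<open>x\<close> to \<open>1\<close>.\<close>

lemma left_inverse:
  assumes x: "x \<in> carrier S" and inj: "\<And>r. r \<in> carrier S \<Longrightarrow> x \<otimes>\<^bsub>S\<^esub> r = \<zero>\<^bsub>S\<^esub> \<Longrightarrow> r = \<zero>\<^bsub>S\<^esub>"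
  shows "\<exists>v\<in>carrier T. v \<otimes>\<^bsub>T\<^esub> i x = \<one>\<^bsub>T\<^esub>"
proof -
  define I where "I = {x \<otimes>\<^bsub>S\<^esub> r |r. r \<in> carrier S}"
  define f where "f = inv_into (carrier S) (\<lambda>r. x \<otimes>\<^bsub>S\<^esub> r)"
  have "inj_on (\<lambda>r. x \<otimes>\<^bsub>S\<^esub> r) (carrier S)"
  proof (rule inj_onI)
    fix a b assume ab: "a \<in> carrier S" "b \<in> carrier S" "x \<otimes>\<^bsub>S\<^esub> a = x \<otimes>\<^bsub>S\<^esub> b"
    hence "x \<otimes>\<^bsub>S\<^esub> (a \<ominus>\<^bsub>S\<^esub> b) = \<zero>\<^bsub>S\<^esub>"
      using x by (simp add: S.minus_eq S.r_distr S.r_minus S.r_neg)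
    thus "a = b" using inj[of "a \<ominus>\<^bsub>S\<^esub> b"] ab by simp
  qed
  hence f: "f (x \<otimes>\<^bsub>S\<^esub> r) = r" if "r \<in> carrier S" for r
    unfolding f_def using inv_into_f_f that by fastforce
  have "\<exists>v\<in>carrier T. \<forall>z\<in>I. v \<otimes>\<^bsub>T\<^esub> i z = i (f z)"
  proof (rule extend)
    show "right_ideal I S" unfolding I_def by (rule S.right_ideal_principal[OF x])
    show "f \<in> I \<rightarrow> carrier S" using f by (auto simp: I_def)
    show "f (a \<oplus>\<^bsub>S\<^esub> b) = f a \<oplus>\<^bsub>S\<^esub> f b" if ab: "a \<in> I" "b \<in> I" for a b
      using ab f x by (auto simp: I_def simp flip: S.r_distr)
    show "f (a \<otimes>\<^bsub>S\<^esub> r) = f a \<otimes>\<^bsub>S\<^esub> r" if ab: "a \<in> I" "r \<in> carrier S" for a r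
      using ab f x by (auto simp: I_def S.m_assoc)
  qed
  moreover have "x \<in> I" unfolding I_def using x by (auto intro!: exI[of _ "\<one>\<^bsub>S\<^esub>"])
  moreover have "f x = \<one>\<^bsub>S\<^esub>" using f[of "\<one>\<^bsub>S\<^esub>"] x by simp
  ultimately show ?thesis using i_simps(4) by metis
qed

text \<open>This one property serves three times: for simplicity, for Type III, and for inverting
  nonzero central elements in \<open>local_NK_subring\<close>.\<close>

lemma factor_one:
  assumes t: "t \<in> carrier S"
    and prime: "\<And>x y. x \<in> carrier S \<Longrightarrow> y \<in> carrier S \<Longrightarrow> x \<noteq> \<zero>\<^bsub>S\<^esub> \<Longrightarrow> y \<noteq> \<zero>\<^bsub>S\<^esub> \<Longrightarrow>
      x \<otimes>\<^bsub>S\<^esub> (t \<otimes>\<^bsub>S\<^esub> y) \<noteq> \<zero>\<^bsub>S\<^esub>"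
    and q: "q \<in> carrier T" "q \<noteq> \<zero>\<^bsub>T\<^esub>"
  shows "\<exists>u\<in>carrier T. \<exists>v\<in>carrier T. v \<otimes>\<^bsub>T\<^esub> q \<otimes>\<^bsub>T\<^esub> u = \<one>\<^bsub>T\<^esub>"
proof -
  obtain s where s: "s \<in> {s \<in> carrier S. q \<otimes>\<^bsub>T\<^esub> i s \<in> i ` carrier S}" "q \<otimes>\<^bsub>T\<^esub> i s \<noteq> \<zero>\<^bsub>T\<^esub>"
    using annihilator[OF q(1) denominators[OF q(1)]] q(2) by blast
  then obtain x where x: "s \<in> carrier S" "x \<in> carrier S" "q \<otimes>\<^bsub>T\<^esub> i s = i x" by blast
  hence xnz: "x \<noteq> \<zero>\<^bsub>S\<^esub>" using s(2) i_zero by auto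
  obtain v where v: "v \<in> carrier T" "v \<otimes>\<^bsub>T\<^esub> i (x \<otimes>\<^bsub>S\<^esub> t) = \<one>\<^bsub>T\<^esub>"
    using left_inverse[of "x \<otimes>\<^bsub>S\<^esub> t"] prime[OF x(2) _ xnz] x(2) t by (auto simp: S.m_assoc)
  have "v \<otimes>\<^bsub>T\<^esub> q \<otimes>\<^bsub>T\<^esub> i (s \<otimes>\<^bsub>S\<^esub> t) = v \<otimes>\<^bsub>T\<^esub> ((q \<otimes>\<^bsub>T\<^esub> i s) \<otimes>\<^bsub>T\<^esub> i t)"
    using q(1) v(1) x(1) t by (simp add: i_simps m_assoc)
  also have "\<dots> = \<one>\<^bsub>T\<^esub>" unfolding x(3) using v(2) x t by (simp add: i_simps)
  finally show ?thesis using v(1) x(1) t i_simps(1) S.m_closed by blast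
qed

text \<open>Were \<open>v\<close> a two-sided inverse of \<open>y\<close>, every \<open>s\<close>
  would satisfy \<open>z s = y (v z s)\<close>. A nonzero denominator \<open>s\<close> of
  \<open>v z\<close> brings this equation down to \<open>S\<close>, where \<open>disj\<close>
  excludes it.\<close>

lemma not_directly_finite:
  assumes yz: "y \<in> carrier S" "z \<in> carrier S" and one: "\<one>\<^bsub>S\<^esub> \<noteq> \<zero>\<^bsub>S\<^esub>"
    and inj: "\<And>r. r \<in> carrier S \<Longrightarrow> y \<otimes>\<^bsub>S\<^esub> r = \<zero>\<^bsub>S\<^esub> \<Longrightarrow> r = \<zero>\<^bsub>S\<^esub>"
    and disj: "\<And>r s. r \<in> carrier S \<Longrightarrow> s \<in> carrier S \<Longrightarrow> y \<otimes>\<^bsub>S\<^esub> r = z \<otimes>\<^bsub>S\<^esub> s \<Longrightarrow> s = \<zero>\<^bsub>S\<^esub>"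
  shows "\<exists>v\<in>carrier T. v \<otimes>\<^bsub>T\<^esub> i y = \<one>\<^bsub>T\<^esub> \<and> i y \<otimes>\<^bsub>T\<^esub> v \<noteq> \<one>\<^bsub>T\<^esub>"
proof -
  obtain v where v: "v \<in> carrier T" "v \<otimes>\<^bsub>T\<^esub> i y = \<one>\<^bsub>T\<^esub>"
    using left_inverse[OF yz(1) inj] by blast
  have "i y \<otimes>\<^bsub>T\<^esub> v \<noteq> \<one>\<^bsub>T\<^esub>"
  proof
    assume e: "i y \<otimes>\<^bsub>T\<^esub> v = \<one>\<^bsub>T\<^esub>"
    have w: "v \<otimes>\<^bsub>T\<^esub> i z \<in> carrier T" using v yz i_simps(1) by simp
    obtain s where s: "s \<in> carrier S" "\<one>\<^bsub>S\<^esub> \<otimes>\<^bsub>S\<^esub> s \<in> {s \<in> carrier S. v \<otimes>\<^bsub>T\<^esub> i z \<otimes>\<^bsub>T\<^esub> i s \<in> i ` carrier S}"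
      "\<one>\<^bsub>S\<^esub> \<otimes>\<^bsub>S\<^esub> s \<noteq> \<zero>\<^bsub>S\<^esub>"
      using S.essE[OF denominators[OF w] S.one_closed one] .
    then obtain r where r: "r \<in> carrier S" "v \<otimes>\<^bsub>T\<^esub> i z \<otimes>\<^bsub>T\<^esub> i s = i r" by auto
    have "i (y \<otimes>\<^bsub>S\<^esub> r) = i y \<otimes>\<^bsub>T\<^esub> (v \<otimes>\<^bsub>T\<^esub> i z \<otimes>\<^bsub>T\<^esub> i s)"
      using yz r by (simp add: i_simps)
    also have "\<dots> = (i y \<otimes>\<^bsub>T\<^esub> v) \<otimes>\<^bsub>T\<^esub> (i z \<otimes>\<^bsub>T\<^esub> i s)"
      using yz s(1) v(1) i_simps(1) by (simp add: m_assoc)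
    also have "\<dots> = i (z \<otimes>\<^bsub>S\<^esub> s)" unfolding e using yz s(1) i_simps by simp
    finally have "y \<otimes>\<^bsub>S\<^esub> r = z \<otimes>\<^bsub>S\<^esub> s" using i_eq_iff yz r(1) s(1) by simp
    hence "s = \<zero>\<^bsub>S\<^esub>" using disj r(1) s(1) by blast
    thus False using s by simp
  qed
  thus ?thesis using v by blast
qed

end

section \<open>Embedding and descent to a countable local subring\<close>

lemma (in ring) prime_ring_embeds:
  fixes g :: "nat set set \<Rightarrow> 'c"
  assumes g: "inj g" and countable: "countable (carrier R)" and one: "\<one> \<noteq> \<zero>"
    and prime: "\<And>x y. x \<in> carrier R \<Longrightarrow> y \<in> carrier R \<Longrightarrow> x \<noteq> \<zero> \<Longrightarrow> y \<noteq> \<zero> \<Longrightarrow>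
      \<exists>r\<in>carrier R. x \<otimes> r \<otimes> y \<noteq> \<zero>"
  shows "\<exists>(T :: 'c ring) h. ring T \<and> simple_ring T \<and> right_self_injective T \<and>
    von_neumann_regular T \<and> type_III T \<and> h \<in> ring_hom R T \<and> inj_on h (carrier R) \<and>
    (\<forall>q\<in>carrier T. q \<noteq> \<zero>\<^bsub>T\<^esub> \<longrightarrow>
      (\<exists>u\<in>carrier T. \<exists>v\<in>carrier T. v \<otimes>\<^bsub>T\<^esub> q \<otimes>\<^bsub>T\<^esub> u = \<one>\<^bsub>T\<^esub>))"
proof -
  define S where "S = series_ring R"
  interpret S: ring S unfolding S_def by (rule series_ring_ring)
  obtain t where t: "t \<in> carrier S"
    and tprime: "\<And>x y. x \<in> carrier S \<Longrightarrow> y \<in> carrier S \<Longrightarrow> x \<noteq> \<zero>\<^bsub>S\<^esub> \<Longrightarrow> y \<noteq> \<zero>\<^bsub>S\<^esub> \<Longrightarrow>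
      x \<otimes>\<^bsub>S\<^esub> (t \<otimes>\<^bsub>S\<^esub> y) \<noteq> \<zero>\<^bsub>S\<^esub>"
    using series_ring_strongly_prime[OF countable prime] unfolding S_def by blast
  interpret S: nonsingular_ring S by (rule S.nonsingular_ringI[OF t tprime])
  \<comment> \<open>A pair of series is coded by the graph of its coefficients: an entry records the
    component (the Boolean \<open>k\<close>), the word, and the number of the coefficient.\<close>
  define enc :: "(nat list \<Rightarrow> 'a) \<times> (nat list \<Rightarrow> 'a) \<Rightarrow> nat set" where
    "enc p = (\<lambda>(k, l). to_nat (k, l, to_nat_on (carrier R) (if k then fst p l else snd p l))) ` UNIV" for p
  have enc: "inj_on enc (carrier S \<times> carrier S)"
  proof (rule inj_onI)
    fix p q assume pq: "p \<in> carrier S \<times> carrier S" "q \<in> carrier S \<times> carrier S" "enc p = enc q"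
    have c: "fst p l \<in> carrier R" "snd p l \<in> carrier R" "fst q l \<in> carrier R" "snd q l \<in> carrier R" for l
      using pq(1,2) by (auto simp: S_def series_ring_def)
    have e: "to_nat_on (carrier R) (if k then fst p l else snd p l)
        = to_nat_on (carrier R) (if k then fst q l else snd q l)" for k l
    proof -
      have "to_nat (k, l, to_nat_on (carrier R) (if k then fst p l else snd p l)) \<in> enc p"
        unfolding enc_def by (rule range_eqI[of _ _ "(k, l)"]) simp
      thus ?thesis unfolding pq(3) by (auto simp: enc_def)
    qed
    note inj = inj_onD[OF inj_on_to_nat_on[OF countable]]
    have "fst p l = fst q l" "snd p l = snd q l" for l
      using inj[of "fst p l" "fst q l"] inj[of "snd p l" "snd q l"] e[of True l] e[of False l] c
      by auto
    thus "p = q" by (auto simp: prod_eq_iff fun_eq_iff)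
  qed
  have "inj_on (\<lambda>p. enc ` p) (carrier S.max_quot)"
  proof (rule inj_on_subset[OF inj_on_image_Pow[OF enc]])
    show "carrier S.max_quot \<subseteq> Pow (carrier S \<times> carrier S)"
      using S.pmapD(1,2)[OF S.max_quotD(1)] by auto
  qed
  hence \<phi>: "inj_on (g \<circ> (\<lambda>p. enc ` p)) (carrier S.max_quot)"
    by (rule comp_inj_on) (rule inj_on_subset[OF g subset_UNIV])
  define T where "T = image_ring (g \<circ> (\<lambda>p. enc ` p)) S.max_quot"
  define i where "i = (g \<circ> (\<lambda>p. enc ` p)) \<circ> S.lmul"
  interpret T: right_quotient S T i
    unfolding T_def i_def by (rule S.right_quotient_exists[OF \<phi>])
  note factor = T.factor_one[OF t tprime]
  have S1: "\<one>\<^bsub>S\<^esub> \<noteq> \<zero>\<^bsub>S\<^esub>"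
    using one by (auto simp: S_def series_ring_def ser_const_def fun_eq_iff)
  have T1: "\<zero>\<^bsub>T\<^esub> \<noteq> \<one>\<^bsub>T\<^esub>"
    using S1 T.i_eq_iff[of "\<one>\<^bsub>S\<^esub>" "\<zero>\<^bsub>S\<^esub>"] T.i_zero T.i_simps(4) by auto
  have var: "ser_var R k \<in> carrier S" for k
    unfolding S_def by (rule ser_var_closed)
  note inj0 = series_var_inj[of _ 0, folded S_def] and disj01 = series_var_cancel[of _ _ 0 1, folded S_def]
  obtain v where v: "v \<in> carrier T" "v \<otimes>\<^bsub>T\<^esub> i (ser_var R 0) = \<one>\<^bsub>T\<^esub>" "i (ser_var R 0) \<otimes>\<^bsub>T\<^esub> v \<noteq> \<one>\<^bsub>T\<^esub>"
    using T.not_directly_finite[OF var[of 0] var[of 1] S1] inj0 disj01 zero_neq_one by blast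
  have "type_III T"
    by (rule T.type_III_criterion[OF factor T.i_simps(1)[OF var] v])
  moreover have "simple_ring T"
    by (rule T.simple_ringI[OF T1 factor])
  moreover have "i \<circ> ser_const R \<in> ring_hom R T"
    using ring_hom_trans[OF ser_const_hom] T.i_hom unfolding S_def by blast
  moreover have "inj_on (i \<circ> ser_const R) (carrier R)"
    using ser_const_closed
    by (intro comp_inj_on ser_const_inj inj_on_subset[OF T.i_inj]) (auto simp: S_def)
  ultimately show ?thesis
    using T.ring_axioms T.right_self_injective T.von_neumann_regular factor by blast
qed

text \<open>Syntax for the subring generated by two elements. Countable syntax makes the subring
  countable, structural induction gives induction over it, and one term can be evaluated on both
  sides of a homomorphism.\<close>

datatype ring_term = FstGen | SndGen | One | MinusOne | Add ring_term ring_term | Mul ring_term ring_term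

instance ring_term :: countable
  by countable_datatype

primrec term_val :: "('a, 'm) ring_scheme \<Rightarrow> 'a \<Rightarrow> 'a \<Rightarrow> ring_term \<Rightarrow> 'a" where
  "term_val R a b FstGen = a"
| "term_val R a b SndGen = b"
| "term_val R a b One = \<one>\<^bsub>R\<^esub>"
| "term_val R a b MinusOne = \<ominus>\<^bsub>R\<^esub> \<one>\<^bsub>R\<^esub>"
| "term_val R a b (Add s t) = term_val R a b s \<oplus>\<^bsub>R\<^esub> term_val R a b t"
| "term_val R a b (Mul s t) = term_val R a b s \<otimes>\<^bsub>R\<^esub> term_val R a b t"

section \<open>Generated subrings, prime ideals and central fractions\<close>

context ring
begin

lemma term_val_closed:
  "a \<in> carrier R \<Longrightarrow> b \<in> carrier R \<Longrightarrow> term_val R a b t \<in> carrier R"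
  by (induction t) auto

lemma term_val_subring:
  assumes "a \<in> carrier R" "b \<in> carrier R"
  shows "subring (range (term_val R a b)) R"
proof (rule subringI)
  note c = term_val_closed[OF assms]
  show "range (term_val R a b) \<subseteq> carrier R" using c by blast
  show "\<one> \<in> range (term_val R a b)" by (rule range_eqI[of _ _ One]) simp
  show "\<ominus> h \<in> range (term_val R a b)" if h: "h \<in> range (term_val R a b)" for h
  proof -
    obtain t where t: "h = term_val R a b t" using h by blast
    have "\<ominus> h = term_val R a b (Mul MinusOne t)" using c t by (simp add: l_minus)
    thus ?thesis by blast
  qed
  show "h \<otimes> k \<in> range (term_val R a b)" "h \<oplus> k \<in> range (term_val R a b)"
    if h: "h \<in> range (term_val R a b)" "k \<in> range (term_val R a b)" for h k
  proof -
    obtain s t where st: "h = term_val R a b s" "k = term_val R a b t" using h by blast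
    have "h \<otimes> k = term_val R a b (Mul s t)" "h \<oplus> k = term_val R a b (Add s t)" using st by auto
    thus "h \<otimes> k \<in> range (term_val R a b)" "h \<oplus> k \<in> range (term_val R a b)" by blast+
  qed
qed

lemma nat_pow_restrict: "x [^]\<^bsub>R\<lparr>carrier := K\<rparr>\<^esub> (n::nat) = x [^] n"
  by (simp add: nat_pow_def)

lemma nilpotent_restrict: "nilpotent_elem (R\<lparr>carrier := K\<rparr>) x \<longleftrightarrow> nilpotent_elem R x"
  by (simp add: nilpotent_elem_def nat_pow_restrict)

text \<open>Carries nilpotency of \<open>a\<close> and \<open>b\<close> times a term, known in the
  original ring for every term, over to the images of \<open>a\<close> and \<open>b\<close>.\<close>

lemma hom_term_val:
  assumes K: "subring K R" and H: "H \<in> ring_hom (R\<lparr>carrier := K\<rparr>) T" and T: "ring T"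
    and ab: "a \<in> K" "b \<in> K"
  shows "term_val R a b t \<in> K \<and> H (term_val R a b t) = term_val T (H a) (H b) t"
proof -
  interpret T: ring T by (rule T)
  interpret K: ring "R\<lparr>carrier := K\<rparr>" by (rule subring_is_ring[OF K])
  note K' = subringE[OF K]
  have h: "H (x \<oplus> y) = H x \<oplus>\<^bsub>T\<^esub> H y" "H (x \<otimes> y) = H x \<otimes>\<^bsub>T\<^esub> H y" "H x \<in> carrier T"
    if "x \<in> K" "y \<in> K" for x y
    using ring_hom_add[OF H, of x y] ring_hom_mult[OF H, of x y] ring_hom_closed[OF H, of x] that
    by simp_all
  have h1: "H \<one> = \<one>\<^bsub>T\<^esub>" using ring_hom_one[OF H] by simp
  have h0: "H \<zero> = \<zero>\<^bsub>T\<^esub>" using ring_hom_zero[OF H K.ring_axioms T] by simp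
  have "H (\<ominus> \<one>) \<oplus>\<^bsub>T\<^esub> \<one>\<^bsub>T\<^esub> = H (\<ominus> \<one> \<oplus> \<one>)"
    using h(1)[of "\<ominus> \<one>" \<one>] K'(3,5) h1 by simp
  hence "H (\<ominus> \<one>) = \<ominus>\<^bsub>T\<^esub> \<one>\<^bsub>T\<^esub>"
    using h0 h(3)[of "\<ominus> \<one>"] K'(3,5) T.minus_equality[of "H (\<ominus> \<one>)" "\<one>\<^bsub>T\<^esub>"] by (simp add: l_neg)
  thus ?thesis
    by (induction t) (use ab K' h h1 in auto)
qed

text \<open>\<open>P\<close> is maximal among the ideals without powers of \<open>c\<close>. If
  \<open>x R y \<subseteq> P\<close> with \<open>x\<close> and \<open>y\<close> outside
  \<open>P\<close>, ideals properly above \<open>P\<close> allow \<open>y\<close> to be replaced by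
  some \<open>c^m\<close> and then \<open>x\<close> by some \<open>c^n\<close>, which puts
  \<open>c^(n+m)\<close> into \<open>P\<close>.\<close>

lemma ex_prime_ideal_avoiding:
  assumes c: "c \<in> carrier R" "\<not> nilpotent_elem R c"
  shows "\<exists>P. ideal P R \<and> (\<forall>n::nat. c [^] n \<notin> P) \<and>
    (\<forall>x\<in>carrier R. \<forall>y\<in>carrier R. x \<notin> P \<longrightarrow> y \<notin> P \<longrightarrow> (\<exists>r\<in>carrier R. x \<otimes> r \<otimes> y \<notin> P))"
proof -
  have idI: "ideal I R" if "right_ideal I R" "\<And>r x. r \<in> carrier R \<Longrightarrow> x \<in> I \<Longrightarrow> r \<otimes> x \<in> I" for I
    using that unfolding right_ideal_def additive_subgroup_def
    by (intro idealI ring_axioms) blast+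
  have idD: "right_ideal I R" if "ideal I R" for I
  proof -
    interpret I: ideal I R by (rule that)
    show ?thesis
      unfolding right_ideal_def using I.additive_subgroup_axioms I.I_r_closed by blast
  qed
  define A where "A = {I. ideal I R \<and> (\<forall>n::nat. c [^] n \<notin> I)}"
  have "\<exists>M\<in>A. \<forall>L\<in>A. M \<subseteq> L \<longrightarrow> L = M"
  proof (rule subset_Zorn_nonempty)
    have "{\<zero>} \<in> A"
      unfolding A_def using zeroideal c(2) by (auto simp: nilpotent_elem_def)
    thus "A \<noteq> {}" by blast
  next
    fix \<C> assume ne: "\<C> \<noteq> {}" and ch: "subset.chain A \<C>"
    have J: "ideal J R" "\<And>n::nat. c [^] n \<notin> J" if "J \<in> \<C>" for J
      using ch that unfolding subset_chain_def A_def by blast+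
    have "ideal (\<Union>\<C>) R"
    proof (rule idI[OF right_idealI])
      show "\<Union>\<C> \<subseteq> carrier R" using right_idealD(1)[OF idD[OF J(1)]] by blast
      show "\<zero> \<in> \<Union>\<C>" using ne right_idealD(2)[OF idD[OF J(1)]] by blast
      show "x \<otimes> r \<in> \<Union>\<C>" if "x \<in> \<Union>\<C>" "r \<in> carrier R" for x r
        using that right_idealD(4)[OF idD[OF J(1)]] by blast
      show "r \<otimes> x \<in> \<Union>\<C>" if "r \<in> carrier R" "x \<in> \<Union>\<C>" for x r
        using that ideal.I_l_closed[OF J(1)] by blast
      fix x y assume "x \<in> \<Union>\<C>" "y \<in> \<Union>\<C>"
      then obtain M N where MN: "M \<in> \<C>" "N \<in> \<C>" "x \<in> M" "y \<in> N" by blast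
      then obtain L where "L \<in> \<C>" "x \<in> L" "y \<in> L"
        using ch unfolding subset_chain_def by blast
      thus "x \<oplus> y \<in> \<Union>\<C>" using right_idealD(3)[OF idD[OF J(1)]] by blast
    qed
    moreover have "\<forall>n::nat. c [^] n \<notin> \<Union>\<C>" using J(2) by blast
    ultimately show "\<Union>\<C> \<in> A" unfolding A_def by (intro CollectI conjI)
  qed
  then obtain P where PA: "P \<in> A" and PM: "\<forall>L\<in>A. P \<subseteq> L \<longrightarrow> L = P" by blast
  have P: "ideal P R" "\<And>n::nat. c [^] n \<notin> P"
    using PA unfolding A_def by blast+
  have meet: "\<exists>n::nat. c [^] n \<in> L" if L: "ideal L R" "P \<subseteq> L" "x \<in> L" "x \<notin> P" for L x
  proof (rule ccontr)
    assume "\<not> ?thesis"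
    hence "L \<in> A" unfolding A_def using L(1) by blast
    thus False using PM L by blast
  qed
  interpret P: ideal P R by (rule P(1))
  have "\<exists>r\<in>carrier R. x \<otimes> r \<otimes> y \<notin> P"
    if xy: "x \<in> carrier R" "y \<in> carrier R" "x \<notin> P" "y \<notin> P" for x y
  proof (rule ccontr)
    assume "\<not> ?thesis"
    hence xyP: "x \<otimes> r \<otimes> y \<in> P" if "r \<in> carrier R" for r using that by blast
    define L where "L = {w \<in> carrier R. \<forall>r\<in>carrier R. x \<otimes> r \<otimes> w \<in> P}"
    have "ideal L R"
    proof (rule idI[OF right_idealI])
      show "w \<oplus> w' \<in> L" if "w \<in> L" "w' \<in> L" for w w'
        using that xy(1) by (auto simp: L_def r_distr)
      show "w \<otimes> q \<in> L" if wq: "w \<in> L" "q \<in> carrier R" for w q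
      proof -
        have "x \<otimes> r \<otimes> (w \<otimes> q) \<in> P" if "r \<in> carrier R" for r
          using that wq xy(1) P.I_r_closed[of "x \<otimes> r \<otimes> w" q] by (auto simp: L_def m_assoc)
        thus ?thesis using wq by (simp add: L_def)
      qed
      show "q \<otimes> w \<in> L" if wq: "q \<in> carrier R" "w \<in> L" for w q
      proof -
        have "x \<otimes> r \<otimes> (q \<otimes> w) \<in> P" if r: "r \<in> carrier R" for r
        proof -
          have "x \<otimes> (r \<otimes> q) \<otimes> w \<in> P" using wq r by (simp add: L_def)
          thus ?thesis using wq r xy(1) by (simp add: L_def m_assoc)
        qed
        thus ?thesis using wq by (simp add: L_def)
      qed
    qed (use xy(1) in \<open>auto simp: L_def\<close>)
    moreover have "P \<subseteq> L"
      using xy(1) P.I_l_closed P.Icarr by (auto simp: L_def)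
    moreover have "y \<in> L" using xy xyP by (simp add: L_def)
    ultimately obtain m :: nat where m: "c [^] m \<in> L" using meet xy(4) by blast
    \<comment> \<open>The mirror image of \<open>L\<close> with \<open>c^m\<close> in the place of
      \<open>y\<close>: it contains \<open>P\<close> and \<open>x\<close>, hence a power of
      \<open>c\<close>.\<close>
    define K where "K = {w \<in> carrier R. \<forall>r\<in>carrier R. w \<otimes> r \<otimes> c [^] m \<in> P}"
    have cm: "c [^] m \<in> carrier R" using c(1) by simp
    have "ideal K R"
    proof (rule idI[OF right_idealI])
      show "w \<oplus> w' \<in> K" if "w \<in> K" "w' \<in> K" for w w'
        using that cm by (auto simp: K_def l_distr)
      show "w \<otimes> q \<in> K" if wq: "w \<in> K" "q \<in> carrier R" for w q
      proof -
        have "w \<otimes> q \<otimes> r \<otimes> c [^] m \<in> P" if r: "r \<in> carrier R" for r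
        proof -
          have "w \<otimes> (q \<otimes> r) \<otimes> c [^] m \<in> P" using wq r by (simp add: K_def)
          thus ?thesis using wq r cm by (simp add: K_def m_assoc)
        qed
        thus ?thesis using wq by (simp add: K_def)
      qed
      show "q \<otimes> w \<in> K" if wq: "q \<in> carrier R" "w \<in> K" for w q
      proof -
        have "q \<otimes> w \<otimes> r \<otimes> c [^] m \<in> P" if "r \<in> carrier R" for r
          using that wq cm P.I_l_closed[of "w \<otimes> r \<otimes> c [^] m" q] by (auto simp: K_def m_assoc)
        thus ?thesis using wq by (simp add: K_def)
      qed
    qed (use cm in \<open>auto simp: K_def\<close>)
    moreover have "P \<subseteq> K"
      using cm P.I_r_closed P.Icarr by (auto simp: K_def)
    moreover have "x \<in> K" using xy(1) m by (auto simp: K_def L_def)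
    ultimately obtain n :: nat where "c [^] n \<in> K" using meet xy(3) by blast
    hence "c [^] n \<otimes> \<one> \<otimes> c [^] m \<in> P" unfolding K_def by blast
    hence "c [^] (n + m) \<in> P" using c(1) by (simp add: nat_pow_mult)
    thus False using P(2) by blast
  qed
  thus ?thesis using P by blast
qed

text \<open>The assumptions \<open>nil\<close> say that \<open>a\<close> and \<open>b\<close>
  generate nil right ideals in the subring \<open>A\<close> of term values. Passing to fractions
  with central denominators preserves this, so \<open>a\<close> and \<open>b\<close> fall into the
  radical of \<open>B\<close>; modulo that radical only central elements and their inverses
  remain.\<close>

lemma local_NK_subring:
  assumes factor: "\<And>q. q \<in> carrier R \<Longrightarrow> q \<noteq> \<zero> \<Longrightarrow> \<exists>u\<in>carrier R. \<exists>v\<in>carrier R. v \<otimes> q \<otimes> u = \<one>"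
    and ab: "a \<in> carrier R" "b \<in> carrier R" and nn: "\<not> nilpotent_elem R (a \<oplus> b)"
    and nil: "\<And>t. nilpotent_elem R (a \<otimes> term_val R a b t)" "\<And>t. nilpotent_elem R (b \<otimes> term_val R a b t)"
  shows "\<exists>B. subring B R \<and> countable B \<and> local_ring (R\<lparr>carrier := B\<rparr>) \<and> NK (R\<lparr>carrier := B\<rparr>)"
proof -
  define A where "A = range (term_val R a b)"
  have A: "subring A R" unfolding A_def by (rule term_val_subring[OF ab])
  note A' = subringE[OF A]
  have aA: "a \<in> A" "b \<in> A"
    unfolding A_def using range_eqI[of a "term_val R a b" FstGen] range_eqI[of b "term_val R a b" SndGen]
    by simp_all
  \<comment> \<open>Centrality is required in the whole ring, not just in \<open>A\<close>: the
    factors supplied by \<open>factor\<close> lie outside \<open>A\<close> in general and must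
    commute with \<open>z\<close>.\<close>
  define Z where "Z = {z \<in> A. \<forall>x\<in>carrier R. z \<otimes> x = x \<otimes> z}"
  have Zc: "z \<in> carrier R" "z \<in> A" "\<And>x. x \<in> carrier R \<Longrightarrow> z \<otimes> x = x \<otimes> z" if "z \<in> Z" for z
    using that A'(1) unfolding Z_def by blast+
  have Z0: "\<zero> \<in> Z" and Z1: "\<one> \<in> Z" and Zm1: "\<ominus> \<one> \<in> Z"
    using A'(2,3,5) by (auto simp: Z_def l_minus r_minus)
  have Zadd: "z \<oplus> w \<in> Z" if "z \<in> Z" "w \<in> Z" for z w
    using Zc[OF that(1)] Zc[OF that(2)] A'(7) by (simp add: Z_def l_distr r_distr)
  have Zmul: "z \<otimes> w \<in> Z" if zw: "z \<in> Z" "w \<in> Z" for z w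
  proof -
    have "z \<otimes> w \<otimes> x = x \<otimes> (z \<otimes> w)" if x: "x \<in> carrier R" for x
    proof -
      have "z \<otimes> w \<otimes> x = z \<otimes> x \<otimes> w"
        using Zc(1)[OF zw(1)] Zc(1)[OF zw(2)] Zc(3)[OF zw(2) x] x by (simp add: m_assoc)
      also have "\<dots> = x \<otimes> (z \<otimes> w)"
        using Zc(1)[OF zw(1)] Zc(1)[OF zw(2)] Zc(3)[OF zw(1) x] x by (simp add: m_assoc)
      finally show ?thesis .
    qed
    thus ?thesis using Zc(2)[OF zw(1)] Zc(2)[OF zw(2)] A'(6) by (simp add: Z_def)
  qed
  have Zinv: "\<exists>u\<in>carrier R. z \<otimes> u = \<one> \<and> u \<otimes> z = \<one> \<and> (\<forall>x\<in>carrier R. u \<otimes> x = x \<otimes> u)"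
    if z: "z \<in> Z" "z \<noteq> \<zero>" for z
  proof -
    note z' = Zc[OF z(1)]
    obtain u0 v0 where uv: "u0 \<in> carrier R" "v0 \<in> carrier R" "v0 \<otimes> z \<otimes> u0 = \<one>"
      using factor[OF z'(1) z(2)] by blast
    \<comment> \<open>Moving \<open>z\<close> to the front turns \<open>v0 z u0 = 1\<close> into
      \<open>z (v0 u0) = 1\<close>.\<close>
    define u where "u = v0 \<otimes> u0"
    have u: "u \<in> carrier R" using uv by (simp add: u_def)
    have zu: "z \<otimes> u = \<one>"
      using uv z'(1) z'(3)[OF uv(2)] by (simp add: u_def m_assoc[symmetric])
    have uz: "u \<otimes> z = \<one>" using z'(3)[OF u] zu by simp
    have "u \<otimes> x = x \<otimes> u" if x: "x \<in> carrier R" for x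
    proof -
      have "u \<otimes> x = u \<otimes> (x \<otimes> z) \<otimes> u" using u x z'(1) zu by (simp add: m_assoc)
      also have "\<dots> = (u \<otimes> z) \<otimes> x \<otimes> u"
        using z'(3)[OF x] u x z'(1) by (simp add: m_assoc)
      finally show ?thesis using uz x by simp
    qed
    thus ?thesis using u zu uz by blast
  qed
  \<comment> \<open>Fractions described without inverses: some nonzero \<open>z\<close> in
    \<open>Z\<close> clears the denominator of \<open>x\<close>.\<close>
  define B where "B = {x \<in> carrier R. \<exists>z\<in>Z. z \<noteq> \<zero> \<and> z \<otimes> x \<in> A}"
  have Znz: "z \<otimes> w \<noteq> \<zero>" if zw: "z \<in> Z" "w \<in> Z" "z \<noteq> \<zero>" "w \<noteq> \<zero>" for z w
  proof
    assume 0: "z \<otimes> w = \<zero>"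
    obtain u where u: "u \<in> carrier R" "u \<otimes> z = \<one>" using Zinv[OF zw(1,3)] by blast
    have "w = (u \<otimes> z) \<otimes> w" using u Zc(1)[OF zw(2)] by simp
    also have "\<dots> = u \<otimes> (z \<otimes> w)" by (rule m_assoc[OF u(1) Zc(1)[OF zw(1)] Zc(1)[OF zw(2)]])
    finally show False using 0 u zw(4) by simp
  qed
  have one: "\<one> \<noteq> \<zero>"
  proof
    assume "\<one> = \<zero>"
    hence "(a \<oplus> b) [^] (0::nat) = \<zero>" by simp
    thus False using nn unfolding nilpotent_elem_def by blast
  qed
  have AB: "x \<in> B" if "x \<in> A" for x
    using that A'(1) Z1 one unfolding B_def by (auto intro!: bexI[of _ \<one>])
  have B: "subring B R"
  proof (rule subringI)
    show "B \<subseteq> carrier R" by (auto simp: B_def)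
    show "\<one> \<in> B" using AB A'(3) by blast
    show "\<ominus> x \<in> B" if "x \<in> B" for x
      using that A'(5) Zc(1) by (auto simp: B_def r_minus intro!: bexI)
    fix x y assume "x \<in> B" "y \<in> B"
    then obtain z w where x: "x \<in> carrier R" "z \<in> Z" "z \<noteq> \<zero>" "z \<otimes> x \<in> A"
      and y: "y \<in> carrier R" "w \<in> Z" "w \<noteq> \<zero>" "w \<otimes> y \<in> A" by (auto simp: B_def)
    note z' = Zc[OF x(2)] and w' = Zc[OF y(2)]
    have "(z \<otimes> w) \<otimes> (x \<otimes> y) = z \<otimes> (w \<otimes> x) \<otimes> y"
      using x y z'(1) w'(1) by (simp add: m_assoc)
    also have "\<dots> = (z \<otimes> x) \<otimes> (w \<otimes> y)"
      unfolding w'(3)[OF x(1)] using x y z'(1) w'(1) by (simp add: m_assoc)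
    finally have "(z \<otimes> w) \<otimes> (x \<otimes> y) \<in> A" using A'(6)[OF x(4) y(4)] by simp
    thus "x \<otimes> y \<in> B"
      using Zmul[OF x(2) y(2)] Znz[OF x(2) y(2) x(3) y(3)] x(1) y(1) by (auto simp: B_def)
    have "(z \<otimes> w) \<otimes> (x \<oplus> y) = (z \<otimes> w) \<otimes> x \<oplus> z \<otimes> (w \<otimes> y)"
      using x y z'(1) w'(1) by (simp add: m_assoc r_distr)
    also have "(z \<otimes> w) \<otimes> x = w \<otimes> (z \<otimes> x)"
      unfolding z'(3)[OF w'(1)] using x z'(1) w'(1) by (simp add: m_assoc)
    finally have "(z \<otimes> w) \<otimes> (x \<oplus> y) \<in> A"
      using A'(7)[OF A'(6)[OF w'(2) x(4)] A'(6)[OF z'(2) y(4)]] by simp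
    thus "x \<oplus> y \<in> B"
      using Zmul[OF x(2) y(2)] Znz[OF x(2) y(2) x(3) y(3)] x(1) y(1) by (auto simp: B_def)
  qed
  note B' = subringE[OF B]
  have Zinv': "\<exists>u\<in>B. z \<otimes> u = \<one> \<and> u \<otimes> z = \<one> \<and> (\<forall>x\<in>carrier R. u \<otimes> x = x \<otimes> u)"
    if z: "z \<in> Z" "z \<noteq> \<zero>" for z
  proof -
    obtain u where u: "u \<in> carrier R" "z \<otimes> u = \<one>" "u \<otimes> z = \<one>" "\<forall>x\<in>carrier R. u \<otimes> x = x \<otimes> u"
      using Zinv[OF z] by blast
    hence "u \<in> B" using z A'(3) by (auto simp: B_def)
    thus ?thesis using u by blast
  qed
  have "countable B"
  proof (rule countable_subset)
    show "B \<subseteq> (\<Union>z\<in>Z - {\<zero>}. \<Union>w\<in>A. {x \<in> carrier R. z \<otimes> x = w})"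
      by (auto simp: B_def)
    have cA: "countable A" unfolding A_def by simp
    \<comment> \<open>As \<open>z\<close> is invertible, a numerator and a denominator determine at
      most one fraction.\<close>
    have "countable {x \<in> carrier R. z \<otimes> x = w}" if z: "z \<in> Z - {\<zero>}" for z w
    proof -
      obtain u where u: "u \<in> carrier R" "u \<otimes> z = \<one>" using Zinv[of z] z by blast
      have "{x \<in> carrier R. z \<otimes> x = w} \<subseteq> {u \<otimes> w}"
      proof
        fix x assume x: "x \<in> {x \<in> carrier R. z \<otimes> x = w}"
        hence "u \<otimes> w = u \<otimes> z \<otimes> x" using u(1) Zc(1)[of z] z by (auto simp: m_assoc)
        thus "x \<in> {u \<otimes> w}" using u(2) x by simp
      qed
      thus ?thesis by (rule countable_subset) simp
    qed
    moreover have "countable (Z - {\<zero>})"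
      by (rule countable_subset[OF _ cA]) (auto simp: Z_def)
    ultimately show "countable (\<Union>z\<in>Z - {\<zero>}. \<Union>w\<in>A. {x \<in> carrier R. z \<otimes> x = w})"
      using cA by (intro countable_UN) auto
  qed
  define RB where "RB = R\<lparr>carrier := B\<rparr>"
  interpret B: ring RB unfolding RB_def by (rule subring_is_ring[OF B])
  have RB [simp]: "carrier RB = B" "(\<otimes>\<^bsub>RB\<^esub>) = (\<otimes>)" "(\<oplus>\<^bsub>RB\<^esub>) = (\<oplus>)" "\<one>\<^bsub>RB\<^esub> = \<one>" "\<zero>\<^bsub>RB\<^esub> = \<zero>"
    by (simp_all add: RB_def)
  have RBnil: "nilpotent_elem RB x \<longleftrightarrow> nilpotent_elem R x" for x
    unfolding RB_def by (rule nilpotent_restrict)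
  have Bc: "x \<in> carrier R" if "x \<in> B" for x using that B'(1) by blast
  \<comment> \<open>With \<open>u\<close> the central inverse of the denominator \<open>z\<close>,
    \<open>d x = u (d z x)\<close> and \<open>(d x)^n = u^n (d z x)^n\<close>; here
    \<open>z x\<close> is a term value.\<close>
  have nilB: "nilpotent_elem R (d \<otimes> x)"
    if d: "d \<in> A" "\<And>t. nilpotent_elem R (d \<otimes> term_val R a b t)" and x: "x \<in> B" for d x
  proof -
    obtain z where z: "z \<in> Z" "z \<noteq> \<zero>" "z \<otimes> x \<in> A" using x by (auto simp: B_def)
    obtain u where u: "u \<in> carrier R" "u \<otimes> z = \<one>" "\<forall>x\<in>carrier R. u \<otimes> x = x \<otimes> u"
      using Zinv[OF z(1,2)] by blast
    have dc: "d \<in> carrier R" using d A'(1) by blast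
    have xc: "x \<in> carrier R" using Bc[OF x] .
    have zx: "z \<otimes> x \<in> carrier R" using z(3) A'(1) by blast
    obtain t where "z \<otimes> x = term_val R a b t" using z(3) unfolding A_def by blast
    then obtain n :: nat where n: "(d \<otimes> (z \<otimes> x)) [^] n = \<zero>"
      using d(2)[of t] unfolding nilpotent_elem_def by auto
    have "d \<otimes> x = d \<otimes> ((u \<otimes> z) \<otimes> x)" using u(2) xc by simp
    also have "\<dots> = d \<otimes> (u \<otimes> (z \<otimes> x))" using u(1) Zc(1)[OF z(1)] xc m_assoc by metis
    also have "\<dots> = (d \<otimes> u) \<otimes> (z \<otimes> x)" using m_assoc[OF dc u(1) zx] by simp
    also have "\<dots> = u \<otimes> (d \<otimes> (z \<otimes> x))" using m_assoc[OF u(1) dc zx] u(3) dc by simp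
    finally have "(d \<otimes> x) [^] n = u [^] n \<otimes> (d \<otimes> (z \<otimes> x)) [^] n"
      using pow_mult_distrib[of u "d \<otimes> (z \<otimes> x)" n] u dc zx by simp
    hence "(d \<otimes> x) [^] n = \<zero>" using n u(1) by simp
    thus ?thesis unfolding nilpotent_elem_def by blast
  qed
  note nila = nilB[OF aA(1) nil(1)] and nilb = nilB[OF aA(2) nil(2)]
  have ja: "a \<in> B.jac" "b \<in> B.jac"
    by (intro B.nil_imp_jac; use AB aA nila nilb RBnil in simp)+
  note J = B.right_idealD[OF B.jac_right_ideal, simplified] and Jl = B.jac_left[simplified]
  \<comment> \<open>The generators \<open>a\<close> and \<open>b\<close> are radical,
    \<open>1\<close> and \<open>-1\<close> are central. In a product the three terms other than
    \<open>m m'\<close> are absorbed because the radical is a two-sided ideal.\<close>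
  have split: "\<exists>m\<in>Z. \<exists>j\<in>B.jac. term_val R a b t = m \<oplus> j" for t
  proof (induction t)
    case FstGen
    show ?case using Z0 ja(1) ab by (auto intro!: bexI)
  next
    case SndGen
    show ?case using Z0 ja(2) ab by (auto intro!: bexI)
  next
    case One
    show ?case using Z1 J(2) by (auto intro!: bexI)
  next
    case MinusOne
    show ?case using Zm1 J(2) by (auto intro!: bexI)
  next
    case (Add s t)
    then obtain m j m' j' where mj: "m \<in> Z" "j \<in> B.jac" "m' \<in> Z" "j' \<in> B.jac"
      "term_val R a b s = m \<oplus> j" "term_val R a b t = m' \<oplus> j'" by blast
    have "j \<in> carrier R" "j' \<in> carrier R" using mj J(1) Bc by blast+
    hence "term_val R a b (Add s t) = (m \<oplus> m') \<oplus> (j \<oplus> j')"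
      using mj Zc(1) by (simp add: a_ac)
    thus ?case using Zadd[OF mj(1,3)] J(3)[OF mj(2,4)] by blast
  next
    case (Mul s t)
    then obtain m j m' j' where mj: "m \<in> Z" "j \<in> B.jac" "m' \<in> Z" "j' \<in> B.jac"
      "term_val R a b s = m \<oplus> j" "term_val R a b t = m' \<oplus> j'" by blast
    have c: "j \<in> B" "j' \<in> B" "m \<in> B" "m' \<in> B" using mj J(1) Zc(2) AB by blast+
    have "term_val R a b (Mul s t) = m \<otimes> m' \<oplus> (m \<otimes> j' \<oplus> (j \<otimes> m' \<oplus> j \<otimes> j'))"
      unfolding term_val.simps mj(5,6) using c[THEN Bc] by (simp add: l_distr r_distr a_ac)
    moreover have "m \<otimes> j' \<oplus> (j \<otimes> m' \<oplus> j \<otimes> j') \<in> B.jac"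
      by (intro J(3)[OF Jl[OF mj(4) c(3)]] J(3)[OF J(4)[OF mj(2) c(4)]] J(4)[OF mj(2) c(2)])
    ultimately show ?case using Zmul[OF mj(1,3)] by blast
  qed
  have "local_ring RB"
  proof (rule B.local_ringI)
    show "\<one>\<^bsub>RB\<^esub> \<noteq> \<zero>\<^bsub>RB\<^esub>" using one by simp
    fix x assume "x \<in> carrier RB" and xJ: "x \<notin> B.jac"
    hence x: "x \<in> B" by simp
    obtain z where z: "z \<in> Z" "z \<noteq> \<zero>" "z \<otimes> x \<in> A" using x by (auto simp: B_def)
    obtain u where u: "u \<in> B" "u \<otimes> z = \<one>" using Zinv'[OF z(1,2)] by blast
    obtain m j where mj: "m \<in> Z" "j \<in> B.jac" "z \<otimes> x = m \<oplus> j"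
    proof -
      obtain t where "z \<otimes> x = term_val R a b t" using z(3) unfolding A_def by blast
      thus ?thesis using split[of t] that by auto
    qed
    have c: "z \<in> carrier R" "x \<in> carrier R" "u \<in> carrier R" "m \<in> carrier R" "j \<in> carrier R"
      using Zc(1)[OF z(1)] Bc[OF x] Bc[OF u(1)] Zc(1)[OF mj(1)] Bc[OF subsetD[OF J(1) mj(2)]] .
    have "m \<noteq> \<zero>"
    proof
      assume "m = \<zero>"
      hence "u \<otimes> (z \<otimes> x) \<in> B.jac" using mj c Jl[OF mj(2) u(1)] by simp
      thus False using xJ u c by (simp add: m_assoc[symmetric])
    qed
    then obtain m' where m': "m' \<in> B" "m \<otimes> m' = \<one>" "m' \<otimes> m = \<one>" using Zinv'[OF mj(1)] by blast
    \<comment> \<open>\<open>z x = m + j\<close> becomes \<open>1 + j m'\<close> after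
      multiplication by \<open>m'\<close>, and this is right invertible because \<open>j\<close> is
      radical. Centrality of \<open>z\<close> then moves it to the far right, giving the right
      inverse \<open>m' r z\<close> of \<open>x\<close>.\<close>
    obtain r where r: "r \<in> B" "(\<one> \<oplus> j \<otimes> m') \<otimes> r = \<one>"
      using mj(2) m'(1) unfolding B.jac_def by auto
    note c' = c Bc[OF m'(1)] Bc[OF r(1)]
    have "z \<otimes> (x \<otimes> (m' \<otimes> r)) = (m \<oplus> j) \<otimes> (m' \<otimes> r)"
      using c' mj(3) by (simp add: m_assoc[symmetric])
    also have "\<dots> = (m \<otimes> m' \<oplus> j \<otimes> m') \<otimes> r"
      using c' by (simp add: m_assoc l_distr)
    also have "\<dots> = \<one>" using m'(2) r(2) by simp
    finally have zz: "z \<otimes> (x \<otimes> (m' \<otimes> r)) = \<one>" .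
    have "x \<otimes> (m' \<otimes> r \<otimes> z) = (x \<otimes> (m' \<otimes> r)) \<otimes> z"
      using c' by (simp add: m_assoc)
    also have "\<dots> = z \<otimes> (x \<otimes> (m' \<otimes> r))"
      using Zc(3)[OF z(1), of "x \<otimes> (m' \<otimes> r)"] c' by simp
    finally show "\<exists>u\<in>carrier RB. x \<otimes>\<^bsub>RB\<^esub> u = \<one>\<^bsub>RB\<^esub>"
      using zz B'(6) m'(1) r(1) AB[OF Zc(2)[OF z(1)]] by auto
  qed
  moreover have "NK RB"
  proof -
    define I where "I d = {d \<otimes> x |x. x \<in> B}" for d
    have ri: "right_ideal (I d) RB" if "d \<in> B" for d
      using B.right_ideal_principal[of d] that by (simp add: I_def)
    have "nil_set RB (I a)" "nil_set RB (I b)"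
      using nila nilb by (auto simp: nil_set_def I_def RBnil)
    moreover have "a \<oplus> b \<in> ideal_sum RB (I a) (I b)"
    proof -
      have "a \<in> I a" "b \<in> I b"
        unfolding I_def using ab B'(3) by (auto intro!: exI[of _ \<one>])
      thus ?thesis unfolding ideal_sum_def RB by blast
    qed
    hence "\<not> nil_set RB (ideal_sum RB (I a) (I b))"
      using nn by (auto simp: nil_set_def RBnil)
    ultimately show ?thesis
      unfolding NK_def using ri[OF AB[OF aA(1)]] ri[OF AB[OF aA(2)]] by blast
  qed
  ultimately show ?thesis using B \<open>countable B\<close> unfolding RB_def by blast
qed

end

text \<open>Two facts must survive on the way to \<open>T\<close>. Nilpotency of \<open>a\<close>
  and \<open>b\<close> times terms passes through every homomorphism; non-nilpotency of
  \<open>a + b\<close> survives because \<open>P\<close> contains none of its powers and the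
  embedding of the quotient is injective.\<close>

theorem mainTheorem11:
  fixes R :: "'a ring"
  assumes "ring R" and "NK R"
    and large: "\<exists>g :: ('a + nat) set set set \<Rightarrow> 'c. inj g"
  shows "\<exists>(T :: 'c ring) B.
           ring T \<and> simple_ring T \<and> right_self_injective T \<and> von_neumann_regular T \<and>
           (type_II_f T \<or> type_III T) \<and>
           subring B T \<and> countable B \<and>
           local_ring (T\<lparr>carrier := B\<rparr>) \<and> NK (T\<lparr>carrier := B\<rparr>)"
proof -
  interpret R: ring R by (rule assms(1))
  obtain I J where I: "right_ideal I R" "nil_set R I" and J: "right_ideal J R" "nil_set R J"
    and IJ: "\<not> nil_set R (ideal_sum R I J)"
    using assms(2) unfolding NK_def by blast
  obtain a b where ab: "a \<in> I" "b \<in> J" and nn: "\<not> nilpotent_elem R (a \<oplus>\<^bsub>R\<^esub> b)"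
    using IJ unfolding nil_set_def ideal_sum_def by blast
  have abc: "a \<in> carrier R" "b \<in> carrier R"
    using ab R.right_idealD(1)[OF I(1)] R.right_idealD(1)[OF J(1)] by auto
  define K where "K = range (term_val R a b)"
  have K: "subring K R" unfolding K_def by (rule R.term_val_subring[OF abc])
  define RK where "RK = R\<lparr>carrier := K\<rparr>"
  interpret K: ring RK unfolding RK_def by (rule R.subring_is_ring[OF K])
  have aK: "a \<in> K" "b \<in> K"
    unfolding K_def using range_eqI[of a "term_val R a b" FstGen] range_eqI[of b "term_val R a b" SndGen]
    by simp_all
  define c where "c = a \<oplus>\<^bsub>R\<^esub> b"
  have cK: "c \<in> K" using subringE(7)[OF K aK] by (simp add: c_def)
  obtain P where P: "ideal P RK" "\<And>n::nat. c [^]\<^bsub>RK\<^esub> n \<notin> P"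
    and Pprime: "\<And>x y. x \<in> K \<Longrightarrow> y \<in> K \<Longrightarrow> x \<notin> P \<Longrightarrow> y \<notin> P \<Longrightarrow> \<exists>r\<in>K. x \<otimes>\<^bsub>R\<^esub> r \<otimes>\<^bsub>R\<^esub> y \<notin> P"
    using K.ex_prime_ideal_avoiding[of c] cK nn
    unfolding c_def RK_def R.nilpotent_restrict by auto
  interpret P: ideal P RK by (rule P(1))
  define Q where "Q = RK Quot P"
  define \<pi> where "\<pi> = (\<lambda>x. P +>\<^bsub>RK\<^esub> x)"
  interpret Q: ring Q unfolding Q_def by (rule P.quotient_is_ring)
  have \<pi>: "\<pi> \<in> ring_hom RK Q" unfolding \<pi>_def Q_def by (rule P.rcos_ring_hom)
  have Qc: "carrier Q = \<pi> ` K"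
    unfolding Q_def \<pi>_def FactRing_def A_RCOSETS_def' by (auto simp: RK_def)
  have \<pi>0: "\<pi> x = \<zero>\<^bsub>Q\<^esub> \<longleftrightarrow> x \<in> P" if "x \<in> K" for x
  proof -
    have "x \<in> carrier RK" using that by (simp add: RK_def)
    thus ?thesis
      unfolding \<pi>_def Q_def FactRing_def
      using P.a_rcos_const[of x] P.a_rcos_self[of x] by auto
  qed
  have \<pi>m: "\<pi> (x \<otimes>\<^bsub>R\<^esub> y) = \<pi> x \<otimes>\<^bsub>Q\<^esub> \<pi> y" if "x \<in> K" "y \<in> K" for x y
    using ring_hom_mult[OF \<pi>, of x y] that by (simp add: RK_def)
  have "countable K" unfolding K_def by simp
  hence Qcount: "countable (carrier Q)" unfolding Qc by simp
  have Qprime: "\<exists>r\<in>carrier Q. x \<otimes>\<^bsub>Q\<^esub> r \<otimes>\<^bsub>Q\<^esub> y \<noteq> \<zero>\<^bsub>Q\<^esub>"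
    if xy: "x \<in> carrier Q" "y \<in> carrier Q" "x \<noteq> \<zero>\<^bsub>Q\<^esub>" "y \<noteq> \<zero>\<^bsub>Q\<^esub>" for x y
  proof -
    obtain x' y' where x': "x' \<in> K" "x = \<pi> x'" "y' \<in> K" "y = \<pi> y'" using xy(1,2) unfolding Qc by blast
    then obtain r where r: "r \<in> K" "x' \<otimes>\<^bsub>R\<^esub> r \<otimes>\<^bsub>R\<^esub> y' \<notin> P"
      using Pprime[of x' y'] xy(3,4) \<pi>0 by blast
    have "x \<otimes>\<^bsub>Q\<^esub> \<pi> r \<otimes>\<^bsub>Q\<^esub> y \<noteq> \<zero>\<^bsub>Q\<^esub>"
      using \<pi>0[of "x' \<otimes>\<^bsub>R\<^esub> r \<otimes>\<^bsub>R\<^esub> y'"] r x' subringE(6)[OF K] by (simp add: \<pi>m)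
    thus ?thesis using r(1) unfolding Qc by blast
  qed
  have cn: "\<pi> (c [^]\<^bsub>RK\<^esub> (n::nat)) \<noteq> \<zero>\<^bsub>Q\<^esub>" for n
    using \<pi>0[of "c [^]\<^bsub>RK\<^esub> n"] P(2) K.nat_pow_closed[of c n] cK by (simp add: RK_def)
  \<comment> \<open>The powers avoided by \<open>P\<close> include the exponent \<open>0\<close>, so
    \<open>P\<close> does not contain \<open>\<one>\<close> and the quotient is not the zero
    ring.\<close>
  have Q1: "\<one>\<^bsub>Q\<^esub> \<noteq> \<zero>\<^bsub>Q\<^esub>" using cn[of 0] ring_hom_one[OF \<pi>] by simp
  obtain g :: "('a + nat) set set set \<Rightarrow> 'c" where g: "inj g" using large by blast
  \<comment> \<open>\<open>Inr\<close> turns naturals into elements of the sum type, and the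
    singleton supplies the third level of sets.\<close>
  have "inj (\<lambda>A :: nat set set. g {(`) Inr ` A})"
  proof (rule injI)
    fix A A' :: "nat set set" assume "g {(`) Inr ` A} = g {(`) Inr ` A'}"
    hence "(`) (Inr :: nat \<Rightarrow> 'a + nat) ` A = (`) Inr ` A'" using injD[OF g] by blast
    moreover have "inj ((`) (Inr :: nat \<Rightarrow> 'a + nat))" by (simp add: inj_image_eq_iff inj_def)
    ultimately show "A = A'" by (simp add: inj_image_eq_iff)
  qed
  from Q.prime_ring_embeds[OF this Qcount Q1 Qprime]
  obtain T :: "'c ring" and h where T: "ring T" "simple_ring T" "right_self_injective T"
    "von_neumann_regular T" "type_III T" "h \<in> ring_hom Q T" "inj_on h (carrier Q)"
    "\<And>q. q \<in> carrier T \<Longrightarrow> q \<noteq> \<zero>\<^bsub>T\<^esub> \<Longrightarrow>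
      \<exists>u\<in>carrier T. \<exists>v\<in>carrier T. v \<otimes>\<^bsub>T\<^esub> q \<otimes>\<^bsub>T\<^esub> u = \<one>\<^bsub>T\<^esub>" by blast
  interpret T: ring T by (rule T(1))
  define H where "H = h \<circ> \<pi>"
  have H: "H \<in> ring_hom RK T" unfolding H_def by (rule ring_hom_trans[OF \<pi> T(6)])
  interpret H: ring_hom_ring RK T H
    by (rule ring_hom_ringI2[OF K.ring_axioms T(1) H])
  have Hpow: "H (x [^]\<^bsub>R\<^esub> (n::nat)) = H x [^]\<^bsub>T\<^esub> n" if "x \<in> K" for x n
    using H.hom_nat_pow[of x n] that by (simp add: RK_def R.nat_pow_restrict)
  have Hval: "term_val R a b t \<in> K" "H (term_val R a b t) = term_val T (H a) (H b) t" for t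
    using R.hom_term_val[OF K H[unfolded RK_def] T(1) aK] by blast+
  have Hm: "H (x \<otimes>\<^bsub>R\<^esub> y) = H x \<otimes>\<^bsub>T\<^esub> H y" "H (x \<oplus>\<^bsub>R\<^esub> y) = H x \<oplus>\<^bsub>T\<^esub> H y" "H x \<in> carrier T"
    if "x \<in> K" "y \<in> K" for x y
    using H.hom_mult[of x y] H.hom_add[of x y] H.hom_closed[of x] that by (simp_all add: RK_def)
  have H0: "H \<zero>\<^bsub>R\<^esub> = \<zero>\<^bsub>T\<^esub>" using H.hom_zero by (simp add: RK_def)
  have Hnil: "nilpotent_elem T (H d \<otimes>\<^bsub>T\<^esub> term_val T (H a) (H b) t)"
    if d: "d \<in> K" "nilpotent_elem R (d \<otimes>\<^bsub>R\<^esub> term_val R a b t)" for d t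
  proof -
    obtain n :: nat where n: "(d \<otimes>\<^bsub>R\<^esub> term_val R a b t) [^]\<^bsub>R\<^esub> n = \<zero>\<^bsub>R\<^esub>"
      using d(2) unfolding nilpotent_elem_def by blast
    have "(H d \<otimes>\<^bsub>T\<^esub> term_val T (H a) (H b) t) [^]\<^bsub>T\<^esub> n = \<zero>\<^bsub>T\<^esub>"
      using Hpow[OF subringE(6)[OF K d(1) Hval(1)], of t n] n H0 Hm(1)[OF d(1) Hval(1)] Hval(2)
      by simp
    thus ?thesis unfolding nilpotent_elem_def by blast
  qed
  have "nilpotent_elem R (a \<otimes>\<^bsub>R\<^esub> term_val R a b t)" "nilpotent_elem R (b \<otimes>\<^bsub>R\<^esub> term_val R a b t)" for t
    using R.right_idealD(4)[OF I(1) ab(1) R.term_val_closed[OF abc]] I(2)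
      R.right_idealD(4)[OF J(1) ab(2) R.term_val_closed[OF abc]] J(2)
    unfolding nil_set_def by blast+
  note nil = Hnil[OF aK(1) this(1)] Hnil[OF aK(2) this(2)]
  have Hc: "\<not> nilpotent_elem T (H a \<oplus>\<^bsub>T\<^esub> H b)"
  proof
    assume "nilpotent_elem T (H a \<oplus>\<^bsub>T\<^esub> H b)"
    then obtain n :: nat where n: "H c [^]\<^bsub>T\<^esub> n = \<zero>\<^bsub>T\<^esub>"
      unfolding nilpotent_elem_def using Hm(2)[OF aK] by (auto simp: c_def)
    have ck: "c [^]\<^bsub>RK\<^esub> n \<in> K" using K.nat_pow_closed[of c n] cK by (simp add: RK_def)
    have "h (\<pi> (c [^]\<^bsub>RK\<^esub> n)) = h \<zero>\<^bsub>Q\<^esub>"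
      using Hpow[OF cK, of n] n ring_hom_zero[OF T(6) Q.ring_axioms T(1)]
      by (simp add: H_def RK_def R.nat_pow_restrict)
    hence "\<pi> (c [^]\<^bsub>RK\<^esub> n) = \<zero>\<^bsub>Q\<^esub>"
      using inj_onD[OF T(7)] ck Q.zero_closed unfolding Qc by blast
    thus False using cn by blast
  qed
  obtain B where "subring B T" "countable B" "local_ring (T\<lparr>carrier := B\<rparr>)" "NK (T\<lparr>carrier := B\<rparr>)"
    using T.local_NK_subring[OF T(8) Hm(3)[OF aK(1) aK(1)] Hm(3)[OF aK(2) aK(2)] Hc nil] by blast
  thus ?thesis using T by blast
qed

end
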